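(* Let $\Bbbk$ be a commutative unital ring, $\delta\in\Bbbk$, and let $d_1,d_2$ be partial Brauer $k$-diagrams. Let $N_1(d_1,d_2)$ be the number of closed loops in the middle row of $\Gamma(d_1,d_2)$, and set $d_3=d_1\circ d_2$. Let $$\Omega(d_1,d_2)=\big(([k]\setminus\lfloor d_1\rfloor)\cap\lceil d_2\rceil_H\big)\cup\big(([k]\setminus\lceil d_2\rceil)\cap\lfloor d_1\rfloor_H\big).$$ Then the following identities hold in $\mathsf{PB}_k(\delta,1)$: (a) $\bar d_1\,\bar d_2=(\delta-1)^{N_1(d_1,d_2)}\,\bar d_3$ if $\lfloor d_1\rfloor=\lceil d_2\rceil$, and $\bar d_1\,\bar d_2=0$ otherwise. (b) $\tilde d_1\,\tilde d_2=(\delta-1)^{N_1(d_1,d_2)}\,\prod_{i\in S}(1-p_i)\,\tilde d_3$ if $\Omega(d_1,d_2)$ is empty, and $\tilde d_1\,\tilde d_2=0$ otherwise. Here $S$ is the set of all $i\in[k]$ such that $d_3$ has a vertical edge with top endpoint $i$ whose underlying path in $\Gamma(d_1,d_2)$ snakes through some cups and caps in the middle row (i.e. contains at least one horizontal edge of $d_1$ or $d_2$) before emerging to connect to a vertex in the bottom row.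
   Context: Let $[k]=\{1,\dots,k\}$ and $[k]'=\{1',\dots,k'\}$. A $k$-diagram is a set partition of $[k]\sqcup[k]'$, drawn as a graph with top row of vertices $1,\dots,k$ and bottom row $1',\dots,k'$ (left to right) whose connected components are the blocks. A partial Brauer $k$-diagram is one all of whose blocks have size at most $2$; blocks of size $2$ are edges, singletons are isolated vertices. An edge is a cup if both endpoints are in $[k]$, a cap if both are in $[k]'$; cups and caps are horizontal, all other edges are vertical. For diagrams $d_1,d_2$, the graph $\Gamma(d_1,d_2)$ is obtained by placing $d_1$ above $d_2$ and identifying the bottom vertex $i'$ of $d_1$ with the top vertex $i$ of $d_2$ (these form the middle row). $d_1\circ d_2$ is the $k$-diagram on the top row of $d_1$ and the bottom row of $d_2$ in which two vertices are in the same block iff they are connected in $\Gamma(d_1,d_2)$. For $\delta,\delta'\in\Bbbk$, $\mathsf{PB}_k(\delta,\delta')$ is the associative unital $\Bbbk$-algebra, free as a module on the partial Brauer $k$-diagrams, with $d_1d_2=\delta^{N_1(d_1,d_2)}\delta'^{N_2(d_1,d_2)}\,d_1\circ d_2$, where $N_1$ is the number of closed loops and $N_2$ the number of paths (including single vertices) lying entirely in the middle row of $\Gamma(d_1,d_2)$. $p_j$ is the diagram with vertices $j,j'$ isolated and vertical edges $\{i,i'\}$ for $i\ne j$; the $p_j$ are commuting idempotents in $\mathsf{PB}_k(\delta,1)$. For a partial Brauer diagram $d$: $\lceil d\rceil=\{i\in[k]: i \text{ is not isolated in } d\}$, $\lfloor d\rfloor=\{i\in[k]: i'\text{ is not isolated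 in }d\}$; $\lceil d\rceil_H$ (resp. $\lfloor d\rfloor_H$) is the set of $i\in[k]$ such that $i$ (resp. $i'$) is an endpoint of a horizontal edge of $d$. Put $$\bar d=\sum_{d'\le d}(-1)^{\beta(d)-\beta(d')}d',\qquad \tilde d=\prod_{i\in\lceil d\rceil_H}(1-p_i)\;d\prod_{i\in\lfloor d\rfloor_H}(1-p_i),$$ where $\beta$ is the number of blocks and $d'\le d$ means each block of $d'$ is contained in a block of $d$ (equivalently, $d'$ is obtained from $d$ by removing zero or more edges). The product defining $\tilde d$ is computed in $\mathsf{PB}_k(\delta,1)$. *)

theory Defs
  imports "HOL-Algebra.Module" "HOL-Library.Disjoint_Sets" "HOL-Library.Poly_Mapping"
begin

section \<open>Partial Brauer diagrams\<close>

text \<open>The vertex \<open>i\<close> of the top row is \<open>Inl i\<close>, the vertex \<open>i'\<close> of the bottom row is \<open>Inr i\<close>.\<close>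

type_synonym diagram = "(nat + nat) set set"

definition diagram_verts :: "nat \<Rightarrow> (nat + nat) set" where
  "diagram_verts k = {1..k} <+> {1..k}"

definition pb_diagrams :: "nat \<Rightarrow> diagram set" where
  "pb_diagrams k = {d. partition_on (diagram_verts k) d \<and> (\<forall>B\<in>d. card B \<le> 2)}"

definition diagram_edges :: "diagram \<Rightarrow> (nat + nat) set set" where
  "diagram_edges d = {B \<in> d. card B = 2}"

definition is_cup :: "(nat + nat) set \<Rightarrow> bool" where
  "is_cup B \<longleftrightarrow> card B = 2 \<and> B \<subseteq> range Inl"

definition is_cap :: "(nat + nat) set \<Rightarrow> bool" where
  "is_cap B \<longleftrightarrow> card B = 2 \<and> B \<subseteq> range Inr"

definition is_horizontal :: "(nat + nat) set \<Rightarrow> bool" where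
  "is_horizontal B \<longleftrightarrow> is_cup B \<or> is_cap B"

definition id_diagram :: "nat \<Rightarrow> diagram" where
  "id_diagram k = (\<lambda>i. {Inl i, Inr i}) ` {1..k}"

definition p_diagram :: "nat \<Rightarrow> nat \<Rightarrow> diagram" where
  "p_diagram k j = {{Inl j}, {Inr j}} \<union> (\<lambda>i. {Inl i, Inr i}) ` ({1..k} - {j})"

definition top_supp :: "nat \<Rightarrow> diagram \<Rightarrow> nat set" where
  "top_supp k d = {i \<in> {1..k}. {Inl i} \<notin> d}"

definition bot_supp :: "nat \<Rightarrow> diagram \<Rightarrow> nat set" where
  "bot_supp k d = {i \<in> {1..k}. {Inr i} \<notin> d}"

definition top_horiz :: "nat \<Rightarrow> diagram \<Rightarrow> nat set" where
  "top_horiz k d = {i \<in> {1..k}. \<exists>B\<in>diagram_edges d. is_horizontal B \<and> Inl i \<in> B}"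

definition bot_horiz :: "nat \<Rightarrow> diagram \<Rightarrow> nat set" where
  "bot_horiz k d = {i \<in> {1..k}. \<exists>B\<in>diagram_edges d. is_horizontal B \<and> Inr i \<in> B}"


section \<open>The graph \<open>\<Gamma>(d\<^sub>1, d\<^sub>2)\<close>\<close>

datatype gvertex = Upper nat | Middle nat | Lower nat

definition gverts :: "nat \<Rightarrow> gvertex set" where
  "gverts k = Upper ` {1..k} \<union> Middle ` {1..k} \<union> Lower ` {1..k}"

text \<open>
  \<open>\<Gamma>\<close> is a multigraph: a cap \<open>{i', j'}\<close> of \<open>d\<^sub>1\<close> and a cup \<open>{i, j}\<close> of \<open>d\<^sub>2\<close> become two parallel
  edges, forming a closed loop. Hence an edge of \<open>\<Gamma>\<close> is an edge of \<open>d\<^sub>1\<close> or of \<open>d\<^sub>2\<close>, tagged by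
  \<open>Inl\<close> or \<open>Inr\<close> accordingly, and its set of endpoints in \<open>\<Gamma>\<close> is a separate function.
\<close>

type_synonym gedge = "(nat + nat) set + (nat + nat) set"

definition gedges :: "diagram \<Rightarrow> diagram \<Rightarrow> gedge set" where
  "gedges d1 d2 = diagram_edges d1 <+> diagram_edges d2"

fun gends :: "gedge \<Rightarrow> gvertex set" where
  "gends (Inl B) = case_sum Upper Middle ` B"
| "gends (Inr B) = case_sum Middle Lower ` B"

fun ghorizontal :: "gedge \<Rightarrow> bool" where
  "ghorizontal (Inl B) = is_horizontal B"
| "ghorizontal (Inr B) = is_horizontal B"

definition gadj :: "diagram \<Rightarrow> diagram \<Rightarrow> (gvertex \<times> gvertex) set" where
  "gadj d1 d2 = {(u, v). \<exists>e\<in>gedges d1 d2. gends e = {u, v}}"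

definition gcomponents :: "nat \<Rightarrow> diagram \<Rightarrow> diagram \<Rightarrow> gvertex set set" where
  "gcomponents k d1 d2 = gverts k // (gadj d1 d2)\<^sup>*"

definition gpath :: "diagram \<Rightarrow> diagram \<Rightarrow> gvertex list \<Rightarrow> gedge list \<Rightarrow> bool" where
  "gpath d1 d2 vs es \<longleftrightarrow>
     distinct vs \<and> length vs = Suc (length es) \<and>
     (\<forall>n<length es. es ! n \<in> gedges d1 d2 \<and> gends (es ! n) = {vs ! n, vs ! Suc n})"

definition gcycle :: "diagram \<Rightarrow> diagram \<Rightarrow> gvertex list \<Rightarrow> gedge list \<Rightarrow> bool" where
  "gcycle d1 d2 vs es \<longleftrightarrow>
     vs \<noteq> [] \<and> distinct vs \<and> distinct es \<and> length vs = length es \<and>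
     (\<forall>n<length es. es ! n \<in> gedges d1 d2 \<and>
        gends (es ! n) = {vs ! n, vs ! (Suc n mod length vs)})"

definition N1 :: "nat \<Rightarrow> diagram \<Rightarrow> diagram \<Rightarrow> nat" where
  "N1 k d1 d2 = card {C \<in> gcomponents k d1 d2. C \<subseteq> range Middle \<and>
     (\<exists>vs es. gcycle d1 d2 vs es \<and> set vs = C \<and> set es = {e \<in> gedges d1 d2. gends e \<subseteq> C})}"

definition N2 :: "nat \<Rightarrow> diagram \<Rightarrow> diagram \<Rightarrow> nat" where
  "N2 k d1 d2 = card {C \<in> gcomponents k d1 d2. C \<subseteq> range Middle \<and>
     (\<exists>vs es. gpath d1 d2 vs es \<and> set vs = C \<and> set es = {e \<in> gedges d1 d2. gends e \<subseteq> C})}"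

definition diagram_comp :: "nat \<Rightarrow> diagram \<Rightarrow> diagram \<Rightarrow> diagram" where
  "diagram_comp k d1 d2 = diagram_verts k //
     {(x, y). x \<in> diagram_verts k \<and> y \<in> diagram_verts k \<and>
        (case_sum Upper Lower x, case_sum Upper Lower y) \<in> (gadj d1 d2)\<^sup>*}"

definition snakes :: "nat \<Rightarrow> diagram \<Rightarrow> diagram \<Rightarrow> nat set" where
  "snakes k d1 d2 = {i \<in> {1..k}. \<exists>j\<in>{1..k}. {Inl i, Inr j} \<in> diagram_comp k d1 d2 \<and>
     (\<exists>vs es. gpath d1 d2 vs es \<and> hd vs = Upper i \<and> last vs = Lower j \<and>
        (\<exists>e\<in>set es. ghorizontal e))}"

definition Omega :: "nat \<Rightarrow> diagram \<Rightarrow> diagram \<Rightarrow> nat set" where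
  "Omega k d1 d2 =
     (({1..k} - bot_supp k d1) \<inter> top_horiz k d2) \<union> (({1..k} - top_supp k d2) \<inter> bot_horiz k d1)"


section \<open>The partial Brauer algebra\<close>

text \<open>
  Coefficients are taken in the sort \<open>{comm_ring, comm_monoid_mult}\<close> (commutative rings with unit)
  rather than in \<open>comm_ring_1\<close>, because the latter class excludes the zero ring.
\<close>

definition PB :: "nat \<Rightarrow> 'a \<Rightarrow> 'a \<Rightarrow> ('a::{comm_ring,comm_monoid_mult}, diagram \<Rightarrow>\<^sub>0 'a) module" where
  "PB k \<delta> \<delta>' =
    \<lparr> carrier = {x. Poly_Mapping.keys x \<subseteq> pb_diagrams k},
      monoid.mult = (\<lambda>x y. \<Sum>d1\<in>Poly_Mapping.keys x. \<Sum>d2\<in>Poly_Mapping.keys y.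
        Poly_Mapping.single (diagram_comp k d1 d2)
          (Poly_Mapping.lookup x d1 * Poly_Mapping.lookup y d2 *
           (\<delta> ^ N1 k d1 d2 * \<delta>' ^ N2 k d1 d2))),
      one = Poly_Mapping.single (id_diagram k) 1,
      zero = 0,
      add = (+),
      smult = (\<lambda>c. Poly_Mapping.map ((*) c)) \<rparr>"

abbreviation pb_basis :: "diagram \<Rightarrow> diagram \<Rightarrow>\<^sub>0 'a::{comm_ring,comm_monoid_mult}" where
  "pb_basis d \<equiv> Poly_Mapping.single d 1"

text \<open>
  \<open>\<Prod>\<^bsub>i\<in>A\<^esub> (1 - p\<^sub>i)\<close>, with the (commuting) factors multiplied in increasing order of \<open>i\<close>;
  \<^const>\<open>finprod\<close> is not used since the algebra is not commutative.
\<close>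

definition one_minus_p_prod ::
    "nat \<Rightarrow> 'a \<Rightarrow> 'a \<Rightarrow> nat set \<Rightarrow> diagram \<Rightarrow>\<^sub>0 'a::{comm_ring,comm_monoid_mult}" where
  "one_minus_p_prod k \<delta> \<delta>' A =
     foldr (\<lambda>i x. (\<one>\<^bsub>PB k \<delta> \<delta>'\<^esub> \<ominus>\<^bsub>PB k \<delta> \<delta>'\<^esub> pb_basis (p_diagram k i)) \<otimes>\<^bsub>PB k \<delta> \<delta>'\<^esub> x)
       (sorted_list_of_set A) \<one>\<^bsub>PB k \<delta> \<delta>'\<^esub>"

text \<open>
  If \<open>d'\<close> refines \<open>d\<close> then \<open>\<beta>(d') \<ge> \<beta>(d)\<close>, so the exponent is written \<open>\<beta>(d') - \<beta>(d)\<close> to avoid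
  truncated subtraction; the sign is the same.
\<close>

definition pb_bar :: "nat \<Rightarrow> diagram \<Rightarrow> diagram \<Rightarrow>\<^sub>0 'a::{comm_ring,comm_monoid_mult}" where
  "pb_bar k d = (\<Sum>d' | refines (diagram_verts k) d' d.
     Poly_Mapping.single d' ((- 1) ^ (card d' - card d)))"

definition pb_tilde :: "nat \<Rightarrow> 'a \<Rightarrow> diagram \<Rightarrow> diagram \<Rightarrow>\<^sub>0 'a::{comm_ring,comm_monoid_mult}" where
  "pb_tilde k \<delta> d =
     one_minus_p_prod k \<delta> 1 (top_horiz k d) \<otimes>\<^bsub>PB k \<delta> 1\<^esub> pb_basis d
       \<otimes>\<^bsub>PB k \<delta> 1\<^esub> one_minus_p_prod k \<delta> 1 (bot_horiz k d)"

end

theory Submission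
  imports Defs
begin

text \<open>
  Both \<open>pb_bar\<close> and \<open>pb_tilde\<close> are alternating sums over sets of deleted edges of \<open>d\<close>: all edges may
  be deleted in the former, the horizontal ones in the latter. Deleting edges of \<open>d\<^sub>1\<close> and \<open>d\<^sub>2\<close>
  amounts to deleting edges of \<open>\<Gamma>(d\<^sub>1, d\<^sub>2)\<close>, whose components are paths and cycles. The composite
  loses exactly those edges whose component is hit by a deletion, and the loops that are hit
  disappear. As only the set of components hit matters, the alternating sum factorises over the
  components: a loop contributes \<open>\<delta> - 1\<close>; a path joining two outer vertices contributes the
  alternating sum over deleting its edge of \<open>d\<^sub>3\<close> or not, provided that it contains a deletable edge;
  every other component contributes \<open>0\<close> if it contains a deletable edge.

  Multiplication by \<open>\<Prod>(1 - p\<^sub>i)\<close> is the same computation with one of the two diagrams equal to the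
  identity, so the associativity of the algebra is never needed.
\<close>

section \<open>Alternating sums over subsets\<close>

text \<open>The obstacle is that the components of \<Gamma> are not given as explicit paths and
  cycles. The structural facts come from counting instead: a component with n vertices has at least
  n - 1 edges, so its degrees sum to at least 2n - 2, while no vertex exceeds degree two. A
  shortfall of at most two says that a path has two ends, that a component meets the outer rows at
  most twice, and that every edge of a component with two such ends separates them. Loops are
  recognised by all degrees being two, a condition that is easy to follow when edges are deleted.

  The signs survive the passage from edges to components because the nonempty subsets of a nonempty
  finite set have signed count -1, just as for a single element. In (b) only horizontal edges are
  deletable: a nonempty \<open>Omega\<close> means a path that ends in the middle row with a
  horizontal edge, and S arises because a vertical edge of \<open>d3\<close> becomes deletable as
  soon as its path contains a horizontal edge.\<close>

definition alt_sum :: "'b set \<Rightarrow> ('b set \<Rightarrow> 'c::ab_group_add) \<Rightarrow> 'c" where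
  "alt_sum A g = (\<Sum>T\<in>Pow A. if even (card T) then g T else - g T)"

lemma alt_sum_empty [simp]: "alt_sum {} g = g {}"
  by (simp add: alt_sum_def)

lemma alt_sum_cong:
  assumes "A = B" "\<And>T. T \<subseteq> B \<Longrightarrow> f T = g T"
  shows "alt_sum A f = alt_sum B g"
  unfolding alt_sum_def using assms by (intro sum.cong) auto

lemma alt_sum_minus: "alt_sum A (\<lambda>T. - g T) = - alt_sum A g"
  unfolding alt_sum_def sum_negf [symmetric] by (intro sum.cong) auto

lemma alt_sum_insert:
  assumes "finite A" "a \<notin> A"
  shows "alt_sum (insert a A) g = alt_sum A g - alt_sum A (\<lambda>T. g (insert a T))"
proof -
  have inj: "inj_on (insert a) (Pow A)"
    using assms(2) by (auto simp: inj_on_def)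
  have "alt_sum (insert a A) g =
      alt_sum A g + (\<Sum>T\<in>insert a ` Pow A. if even (card T) then g T else - g T)"
    unfolding alt_sum_def Pow_insert using assms by (intro sum.union_disjoint) auto
  also have "(\<Sum>T\<in>insert a ` Pow A. if even (card T) then g T else - g T) =
      (\<Sum>T\<in>Pow A. if even (card (insert a T)) then g (insert a T) else - g (insert a T))"
    by (rule sum.reindex_cong [OF inj]) auto
  also have "\<dots> = (\<Sum>T\<in>Pow A. if even (card T) then - g (insert a T) else g (insert a T))"
    using assms by (intro sum.cong refl) (auto simp: card_insert_if finite_subset)
  also have "\<dots> = alt_sum A (\<lambda>T. - g (insert a T))"
    unfolding alt_sum_def by (intro sum.cong) auto
  finally show ?thesis by (simp add: alt_sum_minus)
qed

text \<open>Toggling \<open>a\<close> pairs subsets of opposite sign and equal value.\<close>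

lemma alt_sum_absorb:
  assumes "finite A" "a \<in> A" "\<And>T. g (insert a T) = g T"
  shows "alt_sum A g = 0"
proof -
  have "alt_sum (insert a (A - {a})) g = 0"
    using assms by (subst alt_sum_insert) auto
  then show ?thesis using assms(2) by (simp add: insert_absorb)
qed

text \<open>Only the fibres met by \<open>T\<close> matter to the summand, and the nonempty subsets
  of one fibre add up to the sign of a single element. This needs no injectivity and is what
  replaces edges by components.\<close>

lemma alt_sum_image:
  assumes "finite A"
  shows "alt_sum A (\<lambda>T. g (f ` T)) = alt_sum (f ` A) g"
  using assms
proof (induction A arbitrary: g)
  case (insert a A)
  have "alt_sum (insert a A) (\<lambda>T. g (f ` T)) =
      alt_sum A (\<lambda>T. g (f ` T)) - alt_sum A (\<lambda>T. g (insert (f a) (f ` T)))"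
    using insert by (simp add: alt_sum_insert)
  also have "\<dots> = alt_sum (f ` A) g - alt_sum (f ` A) (\<lambda>T. g (insert (f a) T))"
    using insert.IH [of g] insert.IH [of "\<lambda>T. g (insert (f a) T)"] by simp
  also have "\<dots> = alt_sum (f ` insert a A) g"
  proof (cases "f a \<in> f ` A")
    case True
    \<comment> \<open>The image does not grow here, so the subtracted sum has to vanish: its summand
      cannot tell whether \<open>f a\<close> is in \<open>T\<close>.\<close>
    have "alt_sum (f ` A) (\<lambda>T. g (insert (f a) T)) = 0"
      by (rule alt_sum_absorb [of _ "f a"]) (use insert True in auto)
    then show ?thesis using True by (simp add: insert_absorb)
  next
    case False
    then show ?thesis using insert by (simp add: alt_sum_insert)
  qed
  finally show ?case .
qed simp

lemma alt_sum_Un: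
  assumes "finite A" "finite B" "A \<inter> B = {}"
  shows "alt_sum (A \<union> B) g = alt_sum A (\<lambda>S. alt_sum B (\<lambda>T. g (S \<union> T)))"
  using assms
proof (induction A arbitrary: g)
  case (insert a A)
  then have "alt_sum (insert a A \<union> B) g =
      alt_sum (A \<union> B) g - alt_sum (A \<union> B) (\<lambda>T. g (insert a T))"
    by (simp add: alt_sum_insert)
  also have "\<dots> = alt_sum A (\<lambda>S. alt_sum B (\<lambda>T. g (S \<union> T))) -
      alt_sum A (\<lambda>S. alt_sum B (\<lambda>T. g (insert a (S \<union> T))))"
    using insert.IH [of g] insert.IH [of "\<lambda>T. g (insert a T)"] insert.prems by simp
  also have "\<dots> = alt_sum (insert a A) (\<lambda>S. alt_sum B (\<lambda>T. g (S \<union> T)))"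
    using insert by (simp add: alt_sum_insert)
  finally show ?case .
qed simp

lemma alt_sum_Plus:
  assumes "finite A" "finite B"
  shows "alt_sum (A <+> B) g = alt_sum A (\<lambda>S. alt_sum B (\<lambda>T. g (S <+> T)))"
proof -
  have "alt_sum (A <+> B) g = alt_sum (Inl ` A) (\<lambda>S. alt_sum (Inr ` B) (\<lambda>T. g (S \<union> T)))"
    unfolding Plus_def using assms by (intro alt_sum_Un) auto
  also have "\<dots> = alt_sum A (\<lambda>S. alt_sum B (\<lambda>T. g (Inl ` S \<union> Inr ` T)))"
    using assms by (simp add: alt_sum_image [symmetric])
  finally show ?thesis by (simp add: Plus_def)
qed

text \<open>Stated for any additive map so as to cover multiplication from either side, scalars, and
  \<open>Poly_Mapping.single d\<close>.\<close>

lemma additive_alt_sum: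
  assumes "\<And>x y. h (x + y) = h x + h y"
  shows "h (alt_sum A g) = alt_sum A (\<lambda>T. h (g T) :: 'd::ab_group_add)"
proof -
  have zero: "h 0 = 0"
    using assms [of 0 0] by simp
  have minus: "h (- x) = - h x" for x
    using assms [of x "- x"] by (simp add: zero add_eq_0_iff)
  have "h (sum f I) = (\<Sum>i\<in>I. h (f i))" for f and I :: "'b set set"
    by (induction I rule: infinite_finite_induct) (simp_all add: zero assms)
  then show ?thesis
    unfolding alt_sum_def by (auto simp: minus intro!: sum.cong)
qed

text \<open>The binomial theorem: a surviving loop contributes \<delta>, a deleted one -1. The free
  factor \<open>c\<close> lets the induction hypothesis absorb the \<delta> of the new
  element.\<close>

lemma alt_sum_power:
  fixes c \<delta> :: "'a::{comm_ring,comm_monoid_mult}"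
  assumes "finite L"
  shows "alt_sum L (\<lambda>T. c * \<delta> ^ card (L - T)) = c * (\<delta> - 1) ^ card L"
  using assms
proof (induction L arbitrary: c)
  case (insert a L)
  have 1: "card (insert a L - T) = Suc (card (L - T))" if "T \<subseteq> L" for T
  proof -
    have "insert a L - T = insert a (L - T)" using insert that by blast
    then show ?thesis using insert by simp
  qed
  have 2: "L - insert a T = L - T" if "T \<subseteq> L" for T
    using insert by blast
  have "alt_sum (insert a L) (\<lambda>T. c * \<delta> ^ card (insert a L - T)) =
      alt_sum L (\<lambda>T. (c * \<delta>) * \<delta> ^ card (L - T)) - alt_sum L (\<lambda>T. c * \<delta> ^ card (L - T))"
    unfolding alt_sum_insert [OF insert.hyps]
    by (intro arg_cong2 [where f = "(-)"] alt_sum_cong refl) (simp_all add: 1 2 mult.assoc)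
  also have "\<dots> = c * (\<delta> * (\<delta> - 1) ^ card L) - c * (\<delta> - 1) ^ card L"
    using insert.IH [of "c * \<delta>"] insert.IH [of c] by (simp only: mult.assoc)
  also have "\<dots> = c * (\<delta> - 1) ^ card (insert a L)"
    using insert by (simp add: algebra_simps)
  finally show ?case .
qed simp

section \<open>Multigraphs of maximal degree two\<close>

definition adj :: "('e \<Rightarrow> 'v set) \<Rightarrow> 'e set \<Rightarrow> ('v \<times> 'v) set" where
  "adj ends E = {(u, v). \<exists>e\<in>E. ends e = {u, v}}"

text \<open>The closure is reflexive on the whole type, so anything outside the graph is a component
  of its own. Positive degree is used later to get back to genuine vertices.\<close>

definition conn :: "('e \<Rightarrow> 'v set) \<Rightarrow> 'e set \<Rightarrow> ('v \<times> 'v) set" where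
  "conn ends E = (adj ends E)\<^sup>*"

definition degree :: "('e \<Rightarrow> 'v set) \<Rightarrow> 'e set \<Rightarrow> 'v \<Rightarrow> nat" where
  "degree ends E v = card {e \<in> E. v \<in> ends e}"

definition is_path :: "('e \<Rightarrow> 'v set) \<Rightarrow> 'e set \<Rightarrow> 'v list \<Rightarrow> 'e list \<Rightarrow> bool" where
  "is_path ends E vs es \<longleftrightarrow> distinct vs \<and> length vs = Suc (length es) \<and>
     (\<forall>n<length es. es ! n \<in> E \<and> ends (es ! n) = {vs ! n, vs ! Suc n})"

text \<open>\<open>distinct es\<close> forbids walking a single edge back and forth, while two
  parallel edges do form a cycle of length two.\<close>

definition is_cycle :: "('e \<Rightarrow> 'v set) \<Rightarrow> 'e set \<Rightarrow> 'v list \<Rightarrow> 'e list \<Rightarrow> bool" where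
  "is_cycle ends E vs es \<longleftrightarrow> vs \<noteq> [] \<and> distinct vs \<and> distinct es \<and> length vs = length es \<and>
     (\<forall>n<length es. es ! n \<in> E \<and> ends (es ! n) = {vs ! n, vs ! (Suc n mod length vs)})"

lemma adj_sym: "(u, v) \<in> adj ends E \<Longrightarrow> (v, u) \<in> adj ends E"
  by (auto simp: adj_def insert_commute)

lemma adjI: "e \<in> E \<Longrightarrow> ends e = {u, v} \<Longrightarrow> (u, v) \<in> adj ends E"
  by (auto simp: adj_def)

lemma conn_refl [simp]: "(u, u) \<in> conn ends E"
  by (simp add: conn_def)

lemma conn_sym: "(u, v) \<in> conn ends E \<Longrightarrow> (v, u) \<in> conn ends E"
  unfolding conn_def by (rule symD [OF sym_rtrancl]) (auto simp: sym_def intro: adj_sym)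

lemma conn_trans: "(u, v) \<in> conn ends E \<Longrightarrow> (v, w) \<in> conn ends E \<Longrightarrow> (u, w) \<in> conn ends E"
  unfolding conn_def by (rule rtrancl_trans)

lemma conn_mono: "E \<subseteq> F \<Longrightarrow> conn ends E \<subseteq> conn ends F"
  unfolding conn_def by (rule rtrancl_mono) (auto simp: adj_def)

lemma component_eq: "v \<in> conn ends E `` {u} \<Longrightarrow> conn ends E `` {v} = conn ends E `` {u}"
  by (auto intro: conn_trans conn_sym)

text \<open>The working form of reachability: later proofs exhibit a set closed under adjacency
  rather than follow a walk.\<close>

lemma component_closed:
  assumes "(u, v) \<in> conn ends E" "u \<in> A"
    and "\<And>e. e \<in> E \<Longrightarrow> ends e \<inter> A \<noteq> {} \<Longrightarrow> ends e \<subseteq> A"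
  shows "v \<in> A"
  using assms(1) unfolding conn_def
proof (induction rule: rtrancl_induct)
  case (step y z)
  then show ?case using assms(3) by (fastforce simp: adj_def)
qed (rule assms)

locale multigraph =
  fixes ends :: "'e \<Rightarrow> 'v set" and E :: "'e set"
  assumes fin: "finite E" and ends2: "e \<in> E \<Longrightarrow> card (ends e) = 2"
begin

lemma multigraph_Diff: "multigraph ends (E - H)"
  by standard (use fin ends2 in auto)

lemma finite_ends: "e \<in> E \<Longrightarrow> finite (ends e)"
  using ends2 [of e] card.infinite by fastforce

lemma obtain_ends:
  assumes "e \<in> E" obtains u v where "ends e = {u, v}" "u \<noteq> v"
  using ends2 [OF assms] by (auto simp: card_2_iff)

lemma conn_ends:
  assumes "e \<in> E" "u \<in> ends e" "v \<in> ends e"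
  shows "(u, v) \<in> conn ends E"
proof -
  obtain a b where ab: "ends e = {a, b}" using obtain_ends [OF assms(1)] by blast
  then have "(a, b) \<in> conn ends E"
    unfolding conn_def using assms(1) by (auto intro: adjI)
  then show ?thesis using ab assms(2,3) by (auto intro: conn_sym)
qed

lemma component_ends: "e \<in> E \<Longrightarrow> v \<in> ends e \<Longrightarrow> conn ends E `` ends e = conn ends E `` {v}"
  using conn_ends by (blast intro: conn_trans)

lemma ends_subset_component:
  "e \<in> E \<Longrightarrow> ends e \<inter> conn ends E `` {u} \<noteq> {} \<Longrightarrow> ends e \<subseteq> conn ends E `` {u}"
  using conn_ends by (blast intro: conn_trans)

lemma finite_component: "finite (conn ends E `` {u})"
proof (rule finite_subset)
  show "conn ends E `` {u} \<subseteq> {u} \<union> \<Union> (ends ` E)"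
  proof
    fix v assume "v \<in> conn ends E `` {u}"
    then have "(u, v) \<in> conn ends E" by simp
    then show "v \<in> {u} \<union> \<Union> (ends ` E)"
      by (rule component_closed) auto
  qed
qed (use fin finite_ends in auto)

text \<open>Double counting of incidences; the closure hypothesis ensures that an edge meeting
  \<open>C\<close> is counted at both ends.\<close>

lemma handshake:
  assumes "finite C" "\<And>e. e \<in> E \<Longrightarrow> ends e \<inter> C \<noteq> {} \<Longrightarrow> ends e \<subseteq> C"
  shows "(\<Sum>v\<in>C. degree ends E v) = 2 * card {e \<in> E. ends e \<subseteq> C}"
proof -
  have "(\<Sum>v\<in>C. degree ends E v) = (\<Sum>v\<in>C. \<Sum>e\<in>E. if v \<in> ends e then 1 else 0)"
    unfolding degree_def using fin by (simp add: sum.If_cases Int_def)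
  also have "\<dots> = (\<Sum>e\<in>E. card (ends e \<inter> C))"
    by (subst sum.swap) (use assms in \<open>simp add: sum.If_cases Int_def conj_commute\<close>)
  also have "\<dots> = (\<Sum>e\<in>E. if ends e \<subseteq> C then 2 else 0)"
  proof (rule sum.cong [OF refl])
    fix e assume e: "e \<in> E"
    show "card (ends e \<inter> C) = (if ends e \<subseteq> C then 2 else 0)"
      using assms(2) [OF e] ends2 [OF e] by (cases "ends e \<inter> C = {}") (auto simp: Int_absorb2)
  qed
  also have "\<dots> = 2 * card {e \<in> E. ends e \<subseteq> C}"
    using fin by (simp add: sum.If_cases Int_def)
  finally show ?thesis .
qed

text \<open>A spanning tree in disguise. Take a maximal \<open>A\<close> around \<open>u\<close>
  that has at least |A| - 1 inner edges; an edge leaving \<open>A\<close> would let it grow by one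
  vertex and at least one edge, so \<open>A\<close> is the whole component.\<close>

lemma component_edges: "card (conn ends E `` {u}) \<le> Suc (card {e \<in> E. ends e \<subseteq> conn ends E `` {u}})"
proof -
  let ?C = "conn ends E `` {u}"
  let ?ok = "\<lambda>A. u \<in> A \<and> A \<subseteq> ?C \<and> card A \<le> Suc (card {e \<in> E. ends e \<subseteq> A})"
  have "finite {A. ?ok A}"
    by (rule finite_subset [of _ "Pow ?C"]) (auto simp: finite_component)
  moreover have "{u} \<in> {A. ?ok A}" by simp
  ultimately obtain A where "A \<in> {A. ?ok A}" "\<forall>B\<in>{A. ?ok A}. A \<subseteq> B \<longrightarrow> A = B"
    using finite_has_maximal2 [of "{A. ?ok A}" "{u}"] by blast
  then have A: "?ok A" and max: "\<And>B. ?ok B \<Longrightarrow> A \<subseteq> B \<Longrightarrow> A = B"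
    by simp_all
  have finA: "finite A" using A finite_component finite_subset by blast
  have "ends e \<subseteq> A" if e: "e \<in> E" "ends e \<inter> A \<noteq> {}" for e
  proof (rule ccontr)
    assume n: "\<not> ends e \<subseteq> A"
    obtain a b where ab: "ends e = {a, b}" using obtain_ends [OF e(1)] by blast
    then obtain v w where vw: "ends e = {v, w}" "v \<in> A" "w \<notin> A"
      using e(2) n by (cases "a \<in> A") (auto simp: insert_commute)
    let ?B = "insert w A"
    have "ends e \<subseteq> ?C" using ends_subset_component [OF e(1)] e(2) A by blast
    moreover have "card ?B \<le> Suc (card {e \<in> E. ends e \<subseteq> ?B})"
    proof -
      have "card (insert e {e \<in> E. ends e \<subseteq> A}) \<le> card {e \<in> E. ends e \<subseteq> ?B}"
        using fin e vw by (intro card_mono) auto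
      then show ?thesis using A finA fin n vw by (simp add: card_insert_if)
    qed
    ultimately have "A = ?B" using A vw by (intro max) auto
    then show False using vw by blast
  qed
  then have "?C \<subseteq> A" using component_closed [of u _ ends E A] A by blast
  with A have "A = ?C" by blast
  with A show ?thesis by simp
qed

lemma degree_Diff1:
  assumes "e \<in> E"
  shows "degree ends E v = degree ends (E - {e}) v + (if v \<in> ends e then 1 else 0)"
proof (cases "v \<in> ends e")
  case True
  then have "{f \<in> E. v \<in> ends f} = insert e {f \<in> E - {e}. v \<in> ends f}" using assms by auto
  then show ?thesis unfolding degree_def using fin True by (simp add: card_insert_if)
next
  case False
  then have "{f \<in> E. v \<in> ends f} = {f \<in> E - {e}. v \<in> ends f}" by auto
  then show ?thesis unfolding degree_def using False by simp
qed

lemma degree_pos: "degree ends E v \<noteq> 0 \<longleftrightarrow> (\<exists>e\<in>E. v \<in> ends e)"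
  unfolding degree_def using fin by (auto simp: card_eq_0_iff)

lemma degree_mono: "F \<subseteq> E \<Longrightarrow> degree ends F v \<le> degree ends E v"
  unfolding degree_def using fin by (intro card_mono) auto

text \<open>Parity: by \<open>handshake\<close> the degrees in a component have an even sum.\<close>

lemma odd_vertex_not_alone:
  assumes "degree ends E x = 1"
    and "\<And>v. v \<in> conn ends E `` {x} \<Longrightarrow> v \<noteq> x \<Longrightarrow> degree ends E v = 2"
  shows False
proof -
  let ?C = "conn ends E `` {x}"
  have "(\<Sum>v\<in>?C. degree ends E v) = degree ends E x + (\<Sum>v\<in>?C - {x}. degree ends E v)"
    by (rule sum.remove) (auto simp: finite_component)
  also have "(\<Sum>v\<in>?C - {x}. degree ends E v) = (\<Sum>v\<in>?C - {x}. 2)"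
    using assms(2) by (intro sum.cong) auto
  finally have "odd (\<Sum>v\<in>?C. degree ends E v)"
    using assms(1) by simp
  then show False
    using handshake [of ?C] finite_component ends_subset_component by simp
qed

section \<open>Paths and cycles as lists of vertices and edges\<close>

lemma exists_path:
  assumes "(x, y) \<in> conn ends E"
  shows "\<exists>vs es. is_path ends E vs es \<and> hd vs = x \<and> last vs = y"
  using assms unfolding conn_def
proof (induction rule: rtrancl_induct)
  case base
  show ?case by (rule exI [of _ "[x]"], rule exI [of _ "[]"]) (simp add: is_path_def)
next
  case (step y z)
  then obtain vs es where p: "is_path ends E vs es" "hd vs = x" "last vs = y" by blast
  obtain e where e: "e \<in> E" "ends e = {y, z}" using step by (auto simp: adj_def)
  have ne: "vs \<noteq> []" using p by (auto simp: is_path_def)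
  show ?case
  proof (cases "z \<in> set vs")
    case False
    have "is_path ends E (vs @ [z]) (es @ [e])"
      unfolding is_path_def
    proof (intro conjI allI impI)
      fix n assume n: "n < length (es @ [e])"
      show "(es @ [e]) ! n \<in> E" using n p e by (auto simp: is_path_def nth_append)
      have "vs ! length es = y" using p ne by (simp add: is_path_def last_conv_nth)
      then show "ends ((es @ [e]) ! n) = {(vs @ [z]) ! n, (vs @ [z]) ! Suc n}"
        using n p e by (auto simp: is_path_def nth_append less_Suc_eq)
    qed (use p False in \<open>auto simp: is_path_def\<close>)
    then show ?thesis using p(2) ne by (intro exI [of _ "vs @ [z]"] exI [of _ "es @ [e]"]) simp
  next
    case True
    then obtain m where m: "m < length vs" "vs ! m = z" by (auto simp: in_set_conv_nth)
    \<comment> \<open>The walk has returned to a vertex of the path, which is cut back to that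
      visit.\<close>
    have "is_path ends E (take (Suc m) vs) (take m es)"
      using p(1) m by (auto simp: is_path_def)
    moreover have "last (take (Suc m) vs) = z" using m by (simp add: take_Suc_conv_app_nth)
    ultimately show ?thesis using p(2) ne
      by (intro exI [of _ "take (Suc m) vs"] exI [of _ "take m es"]) simp
  qed
qed

lemma path_conn:
  assumes "is_path ends E vs es" "n < length vs"
  shows "(hd vs, vs ! n) \<in> conn ends E"
  using assms(2)
proof (induction n)
  case 0
  then show ?case by (cases vs) auto
next
  case (Suc n)
  then have "es ! n \<in> E" "ends (es ! n) = {vs ! n, vs ! Suc n}"
    using assms(1) by (auto simp: is_path_def)
  then have "(vs ! n, vs ! Suc n) \<in> conn ends E" using conn_ends by blast
  then show ?case using Suc by (auto intro: conn_trans)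
qed

lemma path_edge_conn:
  assumes "is_path ends E vs es" "e \<in> set es" "v \<in> ends e"
  shows "(hd vs, v) \<in> conn ends E"
proof -
  obtain n where "n < length es" "es ! n = e" using assms(2) by (auto simp: in_set_conv_nth)
  then show ?thesis using assms path_conn [OF assms(1)] by (force simp: is_path_def)
qed

lemma path_distinct_edges:
  assumes "is_path ends E vs es"
  shows "distinct es"
  unfolding distinct_conv_nth
proof (intro allI impI)
  fix m n assume mn: "m < length es" "n < length es" "m \<noteq> n"
  then have "ends (es ! m) = {vs ! m, vs ! Suc m}" "ends (es ! n) = {vs ! n, vs ! Suc n}"
    using assms by (auto simp: is_path_def)
  moreover have "{vs ! m, vs ! Suc m} \<noteq> {vs ! n, vs ! Suc n}"
    using assms mn by (auto simp: is_path_def doubleton_eq_iff nth_eq_iff_index_eq)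
  ultimately show "es ! m \<noteq> es ! n" by metis
qed

text \<open>The edges before and after \<open>v\<close> on the cycle are distinct. Counting within
  \<open>set es\<close> rather than \<open>E\<close> later shows that no edge at \<open>v\<close>
  lies off the cycle.\<close>

lemma cycle_degree:
  assumes c: "is_cycle ends E vs es" and "v \<in> set vs"
  shows "2 \<le> card {e \<in> set es. v \<in> ends e}"
proof -
  let ?l = "length vs"
  have l: "length es = ?l" "0 < ?l" using c by (auto simp: is_cycle_def)
  obtain n where n: "n < ?l" "vs ! n = v" using assms by (auto simp: in_set_conv_nth)
  have "ends (es ! 0) = {vs ! 0, vs ! (Suc 0 mod ?l)}" "es ! 0 \<in> E"
    using c l by (auto simp: is_cycle_def)
  \<comment> \<open>A cycle of length one would be an edge with a single endpoint.\<close>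
  then have "?l \<noteq> 1" using ends2 [of "es ! 0"] by auto
  with l have l2: "2 \<le> ?l" by linarith
  \<comment> \<open>The cyclic predecessor of \<open>n\<close>.\<close>
  define m where "m = (if n = 0 then ?l - 1 else n - 1)"
  have m: "m < ?l" "m \<noteq> n" "Suc m mod ?l = n" using n l2 by (auto simp: m_def)
  have "{es ! m, es ! n} \<subseteq> {e \<in> set es. v \<in> ends e}"
    using c m n l by (auto simp: is_cycle_def)
  moreover have "es ! m \<noteq> es ! n"
    using c m n l by (simp add: is_cycle_def nth_eq_iff_index_eq)
  ultimately show ?thesis
    using card_mono [of "{e \<in> set es. v \<in> ends e}" "{es ! m, es ! n}"] by simp
qed

end

text \<open>Deletions elsewhere are not felt: the component in \<open>E - H\<close> is closed under
  all edges of \<open>E\<close>.\<close>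

lemma (in multigraph) component_Diff:
  assumes "\<And>e. e \<in> E \<inter> H \<Longrightarrow> ends e \<inter> conn ends E `` {u} = {}"
  shows "conn ends (E - H) `` {u} = conn ends E `` {u}"
proof
  show sub: "conn ends (E - H) `` {u} \<subseteq> conn ends E `` {u}"
    using conn_mono [of "E - H" E ends] by blast
  interpret D: multigraph ends "E - H" by (rule multigraph_Diff)
  show "conn ends E `` {u} \<subseteq> conn ends (E - H) `` {u}"
  proof
    fix v assume "v \<in> conn ends E `` {u}"
    then have "(u, v) \<in> conn ends E" by simp
    then show "v \<in> conn ends (E - H) `` {u}"
    proof (rule component_closed)
      fix e assume e: "e \<in> E" "ends e \<inter> conn ends (E - H) `` {u} \<noteq> {}"
      then have "e \<notin> H" using assms [of e] sub by blast
      then show "ends e \<subseteq> conn ends (E - H) `` {u}"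
        using D.ends_subset_component [of e u] e by blast
    qed simp
  qed
qed

lemma (in multigraph) component_degree_sum:
  "2 * card (conn ends E `` {u}) \<le> (\<Sum>v\<in>conn ends E `` {u}. degree ends E v) + 2"
  using handshake [OF finite_component ends_subset_component] component_edges [of u] by simp

locale multigraph2 = multigraph +
  assumes degree_le2: "degree ends E v \<le> 2"
begin

lemma multigraph2_Diff: "multigraph2 ends (E - H)"
proof -
  interpret D: multigraph ends "E - H" by (rule multigraph_Diff)
  show ?thesis
    by standard (use degree_mono [of "E - H"] degree_le2 in \<open>auto intro: le_trans\<close>)
qed

text \<open>By \<open>component_degree_sum\<close> a component falls short of degree two per vertex
  by at most two in total, and each element of \<open>S\<close> accounts for one.\<close>

lemma component_deficit:
  assumes "S \<subseteq> conn ends E `` {u}" "\<And>v. v \<in> S \<Longrightarrow> degree ends E v \<le> 1"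
  shows "card S \<le> 2"
proof -
  let ?C = "conn ends E `` {u}"
  have "(\<Sum>v\<in>?C. degree ends E v + (if v \<in> S then 1 else 0)) \<le> (\<Sum>v\<in>?C. 2)"
    using assms(2) degree_le2 by (intro sum_mono) auto
  moreover have "(\<Sum>v\<in>?C. if v \<in> S then 1 else 0 :: nat) = card S"
    using assms(1) finite_component by (simp add: sum.If_cases Int_absorb1)
  ultimately show ?thesis
    using component_degree_sum [of u] by (simp add: sum.distrib)
qed

text \<open>The degrees in a connected graph with \<open>n\<close> vertices sum to at least \<open>2n - 2\<close>. If \<open>x\<close> and
  \<open>y\<close> are of degree at most one, this leaves no room for a component of \<open>E - {e}\<close> which contains
  \<open>x\<close>, \<open>y\<close> and an endpoint of \<open>e\<close>.\<close>

lemma bridge: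
  assumes "x \<noteq> y" "degree ends E x \<le> 1" "degree ends E y \<le> 1"
    and e: "e \<in> E" "ends e \<inter> conn ends E `` {x} \<noteq> {}"
  shows "(x, y) \<notin> conn ends (E - {e})"
proof
  assume xy: "(x, y) \<in> conn ends (E - {e})"
  interpret D: multigraph ends "E - {e}" by (rule multigraph_Diff)
  let ?C = "conn ends (E - {e}) `` {x}"
  \<comment> \<open>A walk from \<open>x\<close> to \<open>e\<close> meets an endpoint of
    \<open>e\<close> before it can use \<open>e\<close>, so deleting \<open>e\<close> does not
    prevent this.\<close>
  have "ends e \<inter> ?C \<noteq> {}"
  proof
    assume n: "ends e \<inter> ?C = {}"
    have "v \<in> ?C" if "(x, v) \<in> conn ends E" for v
      using that
    proof (rule component_closed)
      fix f assume "f \<in> E" "ends f \<inter> ?C \<noteq> {}"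
      then show "ends f \<subseteq> ?C"
        using n D.ends_subset_component [of f x] by (cases "f = e") auto
    qed simp
    then show False using e n by blast
  qed
  then have "card (?C \<inter> ends e) \<noteq> 0"
    using D.finite_component by (auto simp: card_eq_0_iff)
  moreover have "card {x, y} = 2" using assms by simp
  moreover have "(\<Sum>v\<in>?C. if v \<in> {x, y} then 1 else 0 :: nat) = card {x, y}"
    using xy D.finite_component by (subst sum.If_cases) (auto intro: arg_cong [where f = card])
  moreover have "(\<Sum>v\<in>?C. if v \<in> ends e then 1 else 0 :: nat) = card (?C \<inter> ends e)"
    using D.finite_component by (simp add: sum.If_cases)
  \<comment> \<open>The first two terms are at most the degree in \<open>E\<close>, which is at most
    one at \<open>x\<close> and \<open>y\<close>, so no vertex exceeds 2. Over \<open>?C\<close> the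
    three terms give at least 2n - 2, 1 and 2, which is too much.\<close>
  moreover have "(\<Sum>v\<in>?C. degree ends (E - {e}) v + (if v \<in> ends e then 1 else 0) +
      (if v \<in> {x, y} then 1 else 0)) \<le> (\<Sum>v\<in>?C. 2)"
    using assms degree_le2
    by (intro sum_mono) (simp add: degree_Diff1 [OF e(1), symmetric])
  ultimately show False
    using D.component_degree_sum [of x] by (simp add: sum.distrib del: insert_iff)
qed

text \<open>A path avoiding \<open>e\<close> would survive in \<open>E - {e}\<close>, against
  \<open>bridge\<close>. Hence any edge of the component can be found on the path, as the definition
  of \<open>snakes\<close> requires.\<close>

lemma path_through:
  assumes "x \<noteq> y" "degree ends E x \<le> 1" "degree ends E y \<le> 1"
    and "(x, y) \<in> conn ends E"
    and e: "e \<in> E" "ends e \<inter> conn ends E `` {x} \<noteq> {}"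
  shows "\<exists>vs es. is_path ends E vs es \<and> hd vs = x \<and> last vs = y \<and> e \<in> set es"
proof -
  obtain vs es where p: "is_path ends E vs es" "hd vs = x" "last vs = y"
    using exists_path [OF assms(4)] by blast
  have "e \<in> set es"
  proof (rule ccontr)
    assume "e \<notin> set es"
    then have "is_path ends (E - {e}) vs es"
      using p(1) by (auto simp: is_path_def in_set_conv_nth)
    moreover have "vs \<noteq> []" using p(1) by (auto simp: is_path_def)
    then have "last vs = vs ! (length vs - 1)" "length vs - 1 < length vs"
      by (simp_all add: last_conv_nth)
    ultimately have "(x, y) \<in> conn ends (E - {e})"
      using multigraph.path_conn [OF multigraph_Diff] p by metis
    then show False using bridge [OF assms(1-3) e] by blast
  qed
  then show ?thesis using p by blast
qed

text \<open>Delete an edge between \<open>u\<close> and some \<open>w\<close>. If this separated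
  them, \<open>u\<close> would be the only vertex of odd degree in its component; so a path from
  \<open>u\<close> to \<open>w\<close> remains, and the edge closes it up.\<close>

lemma cycle_exists:
  assumes deg: "\<And>v. v \<in> conn ends E `` {u} \<Longrightarrow> degree ends E v = 2"
  shows "\<exists>vs es. is_cycle ends E vs es \<and> set vs \<subseteq> conn ends E `` {u}"
proof -
  have "degree ends E u \<noteq> 0" using deg [of u] by simp
  then obtain e where e: "e \<in> E" "u \<in> ends e" using degree_pos by blast
  then obtain w where w: "ends e = {u, w}" "u \<noteq> w"
    using obtain_ends [OF e(1)] by (metis doubleton_eq_iff insertE singletonD)
  interpret D: multigraph ends "E - {e}" by (rule multigraph_Diff)
  have sub: "conn ends (E - {e}) \<subseteq> conn ends E" by (rule conn_mono) blast
  have uw: "(u, w) \<in> conn ends (E - {e})"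
  proof (rule ccontr)
    assume n: "(u, w) \<notin> conn ends (E - {e})"
    have "degree ends (E - {e}) u = 1"
      using deg [of u] degree_Diff1 [OF e(1), of u] e by simp
    moreover have "degree ends (E - {e}) v = 2"
      if "v \<in> conn ends (E - {e}) `` {u}" "v \<noteq> u" for v
    proof -
      have "v \<notin> ends e" using w that n by auto
      then show ?thesis using deg [of v] degree_Diff1 [OF e(1), of v] that sub by auto
    qed
    ultimately show False using D.odd_vertex_not_alone [of u] by blast
  qed
  then obtain vs es where p: "is_path ends (E - {e}) vs es" "hd vs = u" "last vs = w"
    using D.exists_path by blast
  have ne: "vs \<noteq> []" using p(1) by (auto simp: is_path_def)
  have nth: "vs ! 0 = u" "vs ! length es = w"
    using p ne by (auto simp: is_path_def hd_conv_nth last_conv_nth)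
  have "is_cycle ends E vs (es @ [e])"
    unfolding is_cycle_def
  proof (intro conjI allI impI)
    show "distinct (es @ [e])"
      using D.path_distinct_edges [OF p(1)] p(1) by (auto simp: is_path_def in_set_conv_nth)
    fix n assume n: "n < length (es @ [e])"
    show "(es @ [e]) ! n \<in> E" using n p(1) e by (auto simp: is_path_def nth_append)
    show "ends ((es @ [e]) ! n) = {vs ! n, vs ! (Suc n mod length vs)}"
      using n p(1) nth w by (cases "n = length es") (auto simp: is_path_def nth_append)
  qed (use p(1) ne in \<open>auto simp: is_path_def\<close>)
  moreover have "set vs \<subseteq> conn ends E `` {u}"
    using D.path_conn [OF p(1)] p(2) subsetD [OF sub] by (auto simp: in_set_conv_nth)
  ultimately show ?thesis by blast
qed

text \<open>Translates the lists in the definition of \<open>N1\<close> into a degree condition.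
  Conversely, a cycle already uses both edges at each of its vertices, so nothing leaves it and it
  fills the component.\<close>

lemma component_is_cycle_iff:
  assumes C: "C = conn ends E `` {u}"
  shows "(\<exists>vs es. is_cycle ends E vs es \<and> set vs = C \<and> set es = {e \<in> E. ends e \<subseteq> C}) \<longleftrightarrow>
    (\<forall>v\<in>C. degree ends E v = 2)"
proof
  assume "\<exists>vs es. is_cycle ends E vs es \<and> set vs = C \<and> set es = {e \<in> E. ends e \<subseteq> C}"
  then obtain vs es where c: "is_cycle ends E vs es" "set vs = C" "set es = {e \<in> E. ends e \<subseteq> C}"
    by blast
  show "\<forall>v\<in>C. degree ends E v = 2"
  proof
    fix v assume "v \<in> C"
    have "2 \<le> card {e \<in> set es. v \<in> ends e}"
      using cycle_degree [OF c(1)] c(2) \<open>v \<in> C\<close> by blast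
    also have "\<dots> \<le> degree ends E v"
      unfolding degree_def using c(3) fin by (intro card_mono) auto
    finally show "degree ends E v = 2" using degree_le2 [of v] by simp
  qed
next
  assume deg: "\<forall>v\<in>C. degree ends E v = 2"
  then obtain vs es where c: "is_cycle ends E vs es" "set vs \<subseteq> C"
    using cycle_exists [of u] C by blast
  have es: "set es \<subseteq> E" using c by (auto simp: is_cycle_def in_set_conv_nth)
  have all: "e \<in> set es" if e: "e \<in> E" "ends e \<inter> set vs \<noteq> {}" for e
  proof -
    obtain v where v: "v \<in> ends e" "v \<in> set vs" using e by blast
    \<comment> \<open>The cycle supplies two edges at \<open>v\<close>, and there are no
      more.\<close>
    have "{e \<in> set es. v \<in> ends e} = {e \<in> E. v \<in> ends e}"
    proof (rule card_seteq)
      show "card {e \<in> E. v \<in> ends e} \<le> card {e \<in> set es. v \<in> ends e}"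
        using cycle_degree [OF c(1) v(2)] degree_le2 [of v] by (simp add: degree_def)
    qed (use es fin in auto)
    then show ?thesis using e v by blast
  qed
  have es_ends: "ends e \<subseteq> set vs" if e: "e \<in> set es" for e
  proof -
    obtain n where "n < length es" "e = es ! n" using e by (auto simp: in_set_conv_nth)
    moreover have "vs \<noteq> []" using c by (auto simp: is_cycle_def)
    ultimately show ?thesis using c(1) by (auto simp: is_cycle_def intro!: nth_mem mod_less_divisor)
  qed
  obtain v where v: "v \<in> set vs" using c(1) by (cases vs) (auto simp: is_cycle_def)
  have "w \<in> set vs" if "w \<in> C" for w
  proof -
    have "(v, w) \<in> conn ends E"
      using v c(2) that C by (auto intro: conn_trans conn_sym)
    then show ?thesis
      using v by (rule component_closed) (use all es_ends in blast)
  qed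
  then have vs: "set vs = C" using c(2) by blast
  have "e \<in> set es" if "e \<in> E" "ends e \<subseteq> C" for e
    using all that vs ends2 [of e] by (metis Int_absorb2 card.empty zero_neq_numeral)
  then have "set es = {e \<in> E. ends e \<subseteq> C}" using es es_ends vs by blast
  then show "\<exists>vs es. is_cycle ends E vs es \<and> set vs = C \<and> set es = {e \<in> E. ends e \<subseteq> C}"
    using c(1) vs by blast
qed

end

section \<open>Diagrams as matchings\<close>

text \<open>Diagrams are traded for their sets of edges: these determine the isolated vertices, and
  removing edges becomes a set difference.\<close>

definition matching :: "nat \<Rightarrow> diagram \<Rightarrow> bool" where
  "matching k M \<longleftrightarrow> disjoint M \<and> (\<forall>B\<in>M. card B = 2 \<and> B \<subseteq> diagram_verts k)"

definition diagram_of :: "nat \<Rightarrow> diagram \<Rightarrow> diagram" where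
  "diagram_of k M = M \<union> (\<lambda>x. {x}) ` (diagram_verts k - \<Union>M)"

lemma finite_diagram_verts [simp]: "finite (diagram_verts k)"
  by (simp add: diagram_verts_def)

lemma Inl_in_verts [simp]: "Inl i \<in> diagram_verts k \<longleftrightarrow> i \<in> {1..k}"
  and Inr_in_verts [simp]: "Inr i \<in> diagram_verts k \<longleftrightarrow> i \<in> {1..k}"
  by (auto simp: diagram_verts_def)

lemma matching_unique: "matching k M \<Longrightarrow> B \<in> M \<Longrightarrow> B' \<in> M \<Longrightarrow> x \<in> B \<Longrightarrow> x \<in> B' \<Longrightarrow> B = B'"
  unfolding matching_def disjoint_def by blast

lemma matching_mono: "matching k M \<Longrightarrow> N \<subseteq> M \<Longrightarrow> matching k N"
  unfolding matching_def disjoint_def by blast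

lemma matching_Diff: "matching k M \<Longrightarrow> matching k (M - H)"
  by (erule matching_mono) blast

lemma matching_card: "matching k M \<Longrightarrow> B \<in> M \<Longrightarrow> card B = 2"
  by (simp add: matching_def)

lemma matching_verts: "matching k M \<Longrightarrow> B \<in> M \<Longrightarrow> x \<in> B \<Longrightarrow> x \<in> diagram_verts k"
  by (auto simp: matching_def)

lemma finite_matching: "matching k M \<Longrightarrow> finite M"
  by (rule finite_subset [of _ "Pow (diagram_verts k)"]) (auto simp: matching_def)

lemma card_matching_at:
  assumes "matching k M"
  shows "card {B \<in> M. x \<in> B} = (if x \<in> \<Union>M then 1 else 0)"
proof (cases "x \<in> \<Union>M")
  case True
  then obtain B where "B \<in> M" "x \<in> B" by blast
  then have "{B \<in> M. x \<in> B} = {B}" using matching_unique [OF assms] by blast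
  then show ?thesis using True by simp
next
  case False
  then have none: "{B \<in> M. x \<in> B} = {}" by blast
  show ?thesis unfolding none using False by simp
qed

lemma diagram_of_in_pb:
  assumes "matching k M"
  shows "diagram_of k M \<in> pb_diagrams k"
proof -
  have "partition_on (diagram_verts k) (diagram_of k M)"
  proof (rule partition_onI)
    show "disjnt p q" if "p \<in> diagram_of k M" "q \<in> diagram_of k M" "p \<noteq> q" for p q
      using that assms unfolding diagram_of_def matching_def disjoint_def disjnt_def by blast
    show "\<Union> (diagram_of k M) = diagram_verts k"
      using assms unfolding diagram_of_def matching_def by blast
    show "{} \<notin> diagram_of k M"
      using assms unfolding diagram_of_def matching_def by auto
  qed
  moreover have "\<forall>B\<in>diagram_of k M. card B \<le> 2"
    using assms by (auto simp: diagram_of_def matching_def)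
  ultimately show ?thesis by (simp add: pb_diagrams_def)
qed

lemma diagram_edges_diagram_of: "matching k M \<Longrightarrow> diagram_edges (diagram_of k M) = M"
  by (auto simp: diagram_edges_def diagram_of_def matching_def)

lemma matching_diagram_edges:
  assumes "d \<in> pb_diagrams k"
  shows "matching k (diagram_edges d)"
  using assms unfolding pb_diagrams_def partition_on_def matching_def diagram_edges_def disjoint_def
  by blast

lemma diagram_of_diagram_edges:
  assumes "d \<in> pb_diagrams k"
  shows "diagram_of k (diagram_edges d) = d"
proof -
  have p: "partition_on (diagram_verts k) d" using assms by (simp add: pb_diagrams_def)
  have single: "\<exists>x. B = {x}" if B: "B \<in> d" "B \<notin> diagram_edges d" for B
  proof -
    have "B \<noteq> {}" "B \<subseteq> diagram_verts k" "card B \<le> 2"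
      using B p assms by (auto simp: partition_on_def pb_diagrams_def)
    then have "card B \<noteq> 0" using finite_subset [OF _ finite_diagram_verts] by (simp add: card_eq_0_iff)
    with \<open>card B \<le> 2\<close> have "card B = 1" using B by (auto simp: diagram_edges_def)
    then show ?thesis by (simp add: card_1_singleton_iff)
  qed
  have "B \<in> diagram_of k (diagram_edges d)" if B: "B \<in> d" for B
  proof (cases "B \<in> diagram_edges d")
    case False
    then obtain x where x: "B = {x}" using single B by blast
    then have "x \<in> diagram_verts k" using B p by (auto simp: partition_on_def)
    moreover have "x \<notin> C" if "C \<in> diagram_edges d" for C
      using that False x B p unfolding partition_on_def disjoint_def diagram_edges_def
      by (metis (no_types, lifting) disjoint_iff insertI1 mem_Collect_eq)
    ultimately show ?thesis unfolding diagram_of_def x by blast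
  qed (simp add: diagram_of_def)
  moreover have "B \<in> d" if B: "B \<in> diagram_of k (diagram_edges d)" for B
  proof (cases "B \<in> diagram_edges d")
    case False
    then obtain x where x: "B = {x}" "x \<in> diagram_verts k" "x \<notin> \<Union> (diagram_edges d)"
      using B by (auto simp: diagram_of_def)
    then obtain C where "C \<in> d" "x \<in> C" using p by (auto simp: partition_on_def)
    then show ?thesis using single [of C] x by auto
  qed (simp add: diagram_edges_def)
  ultimately show ?thesis by blast
qed

section \<open>The graph of two matchings\<close>

abbreviation outer :: "nat + nat \<Rightarrow> gvertex" where
  "outer \<equiv> case_sum Upper Lower"

definition outer_edges :: "nat \<Rightarrow> gedge set \<Rightarrow> diagram" where
  "outer_edges k G = {{x, y} | x y. x \<in> diagram_verts k \<and> y \<in> diagram_verts k \<and> x \<noteq> y \<and>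
     (outer x, outer y) \<in> conn gends G}"

text \<open>The components counted by \<open>N1\<close>, described by degrees so that deletions can
  be traced.\<close>

definition loops :: "gedge set \<Rightarrow> gvertex set set" where
  "loops G = {C. \<exists>u. C = conn gends G `` {u} \<and> C \<subseteq> range Middle \<and> (\<forall>v\<in>C. degree gends G v = 2)}"

text \<open>Components serve as the common index of the edges of \<Gamma> and those of the
  composite: \<open>edge_comp G e = block_comp G B\<close> says that \<open>e\<close> lies on the
  path underlying \<open>B\<close>. Taking the image of all endpoints avoids choosing one.\<close>

definition edge_comp :: "gedge set \<Rightarrow> gedge \<Rightarrow> gvertex set" where
  "edge_comp G e = conn gends G `` gends e"

definition block_comp :: "gedge set \<Rightarrow> (nat + nat) set \<Rightarrow> gvertex set" where
  "block_comp G B = conn gends G `` (outer ` B)"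

lemma inj_outer: "inj outer"
  and inj_upper_middle: "inj (case_sum Upper Middle)"
  and inj_middle_lower: "inj (case_sum Middle Lower)"
  by (auto simp: inj_on_def split: sum.splits)

lemma outer_eq_iff [simp]: "outer x = outer y \<longleftrightarrow> x = y"
  using inj_outer by (auto simp: inj_on_def)

lemma gends_simps:
  "Upper i \<in> gends (Inl B) \<longleftrightarrow> Inl i \<in> B" "Middle i \<in> gends (Inl B) \<longleftrightarrow> Inr i \<in> B"
  "Lower i \<notin> gends (Inl B)" "Upper i \<notin> gends (Inr B)"
  "Middle i \<in> gends (Inr B) \<longleftrightarrow> Inl i \<in> B" "Lower i \<in> gends (Inr B) \<longleftrightarrow> Inr i \<in> B"
  by (simp_all add: image_iff Bex_def split_sum_ex)

text \<open>The matchings are arbitrary since the locale is instantiated again with edges removed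
  and with one matching being the identity.\<close>

locale gamma_graph =
  fixes k :: nat and M1 M2 :: diagram
  assumes m1: "matching k M1" and m2: "matching k M2"
begin

abbreviation "G \<equiv> M1 <+> M2"

lemma finite_G: "finite G"
  using finite_matching [OF m1] finite_matching [OF m2] by simp

lemma card_gends: "e \<in> G \<Longrightarrow> card (gends e) = 2"
  using m1 m2
  by (elim PlusE) (simp_all add: matching_card card_image
      inj_on_subset [OF inj_upper_middle subset_UNIV] inj_on_subset [OF inj_middle_lower subset_UNIV])

lemma gends_gverts:
  assumes "e \<in> G"
  shows "gends e \<subseteq> gverts k"
proof
  fix v assume "v \<in> gends e"
  then show "v \<in> gverts k"
    using assms matching_verts [OF m1] matching_verts [OF m2]
    by (cases v) (fastforce simp: gends_simps gverts_def simp del: gends.simps)+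
qed

lemma degree_Upper: "degree gends G (Upper i) = (if Inl i \<in> \<Union>M1 then 1 else 0)"
proof -
  have "{e \<in> G. Upper i \<in> gends e} = Inl ` {B \<in> M1. Inl i \<in> B}"
    by (auto simp: gends_simps simp del: gends.simps)
  then show ?thesis
    by (simp add: degree_def card_image card_matching_at [OF m1] del: gends.simps Union_iff)
qed

lemma degree_Lower: "degree gends G (Lower i) = (if Inr i \<in> \<Union>M2 then 1 else 0)"
proof -
  have "{e \<in> G. Lower i \<in> gends e} = Inr ` {B \<in> M2. Inr i \<in> B}"
    by (auto simp: gends_simps simp del: gends.simps)
  then show ?thesis
    by (simp add: degree_def card_image card_matching_at [OF m2] del: gends.simps Union_iff)
qed

lemma degree_Middle: "degree gends G (Middle i) =
    (if Inr i \<in> \<Union>M1 then 1 else 0) + (if Inl i \<in> \<Union>M2 then 1 else 0)"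
proof -
  have "{e \<in> G. Middle i \<in> gends e} = {B \<in> M1. Inr i \<in> B} <+> {B \<in> M2. Inl i \<in> B}"
    by (auto simp: gends_simps simp del: gends.simps)
  then show ?thesis
    using finite_matching [OF m1] finite_matching [OF m2]
    by (simp add: degree_def card_Plus card_matching_at [OF m1] card_matching_at [OF m2]
        del: gends.simps Union_iff)
qed

lemma degree_outer: "degree gends G (outer x) \<le> 1"
  by (cases x) (simp_all add: degree_Upper degree_Lower)

sublocale multigraph2 gends G
proof
  show "degree gends G v \<le> 2" for v
    by (cases v) (simp_all add: degree_Upper degree_Middle degree_Lower)
qed (simp_all only: finite_G card_gends)

text \<open>Outer vertices have degree at most one, so three of them in one component would
  contradict \<open>component_deficit\<close>.\<close>

lemma outer_unique:
  assumes "(outer x, outer y) \<in> conn gends G" "(outer x, outer z) \<in> conn gends G" "x \<noteq> y" "x \<noteq> z"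
  shows "y = z"
proof (rule ccontr)
  assume "y \<noteq> z"
  then have "card (outer ` {x, y, z}) = 3" using assms by (simp add: card_image inj_on_def)
  moreover have "card (outer ` {x, y, z}) \<le> 2"
    by (rule component_deficit [of _ "outer x"]) (use assms degree_outer in auto)
  ultimately show False by simp
qed

lemma outer_edges_mem:
  assumes "B \<in> outer_edges k G" "x \<in> B"
  obtains y where "B = {x, y}" "x \<noteq> y" "(outer x, outer y) \<in> conn gends G"
    "x \<in> diagram_verts k" "y \<in> diagram_verts k"
  using assms unfolding outer_edges_def by (auto dest: conn_sym simp: insert_commute)

lemma block_comp_eq: "B \<in> outer_edges k G \<Longrightarrow> x \<in> B \<Longrightarrow> block_comp G B = conn gends G `` {outer x}"
  by (erule (1) outer_edges_mem) (auto simp: block_comp_def intro: conn_trans conn_sym)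

lemma edge_comp_eq: "e \<in> G \<Longrightarrow> v \<in> gends e \<Longrightarrow> edge_comp G e = conn gends G `` {v}"
  unfolding edge_comp_def by (rule component_ends)

lemma edge_comp_eq_iff: "e \<in> G \<Longrightarrow> edge_comp G e = conn gends G `` {u} \<longleftrightarrow> gends e \<inter> conn gends G `` {u} \<noteq> {}"
proof -
  assume e: "e \<in> G"
  obtain v where v: "v \<in> gends e" using card_gends [OF e] by fastforce
  show ?thesis
  proof
    assume "edge_comp G e = conn gends G `` {u}"
    moreover have "v \<in> edge_comp G e" unfolding edge_comp_def by (rule ImageI [OF conn_refl v])
    ultimately show "gends e \<inter> conn gends G `` {u} \<noteq> {}" using v by blast
  next
    assume "gends e \<inter> conn gends G `` {u} \<noteq> {}"
    then obtain w where "w \<in> gends e" "w \<in> conn gends G `` {u}" by blast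
    then show "edge_comp G e = conn gends G `` {u}"
      using edge_comp_eq [OF e] component_eq by metis
  qed
qed

lemma matching_outer_edges: "matching k (outer_edges k G)"
  unfolding matching_def disjoint_def
proof (intro conjI ballI impI)
  fix B B' assume B: "B \<in> outer_edges k G" "B' \<in> outer_edges k G" "B \<noteq> B'"
  show "B \<inter> B' = {}"
  proof (rule ccontr)
    assume "B \<inter> B' \<noteq> {}"
    then obtain x where x: "x \<in> B" "x \<in> B'" by blast
    obtain y where "B = {x, y}" "x \<noteq> y" "(outer x, outer y) \<in> conn gends G"
      using outer_edges_mem [OF B(1) x(1)] .
    moreover obtain z where "B' = {x, z}" "x \<noteq> z" "(outer x, outer z) \<in> conn gends G"
      using outer_edges_mem [OF B(2) x(2)] .
    ultimately show False using outer_unique B(3) by blast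
  qed
qed (auto simp: outer_edges_def)

text \<open>A component has only two outer vertices, so the block can be read off from it. This
  turns sums over components back into sums over edges of the composite.\<close>

lemma inj_block_comp: "inj_on (block_comp G) (outer_edges k G)"
proof (rule inj_onI)
  fix B B' assume B: "B \<in> outer_edges k G" "B' \<in> outer_edges k G" "block_comp G B = block_comp G B'"
  obtain x y where xy: "B = {x, y}" "x \<noteq> y" "(outer x, outer y) \<in> conn gends G"
    using B(1) by (auto simp: outer_edges_def)
  have "outer ` B \<subseteq> block_comp G B" unfolding block_comp_def by (blast intro: ImageI [OF conn_refl])
  then have "outer ` B \<subseteq> block_comp G B'" by (simp only: B(3))
  then have *: "outer x \<in> block_comp G B'" "outer y \<in> block_comp G B'" using xy(1) by auto
  obtain x' y' where xy': "B' = {x', y'}" "x' \<noteq> y'" "(outer x', outer y') \<in> conn gends G"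
    using B(2) by (auto simp: outer_edges_def)
  have conn: "(outer x', outer x) \<in> conn gends G" "(outer x', outer y) \<in> conn gends G"
    using * block_comp_eq [OF B(2), of x'] unfolding xy'(1) by blast+
  show "B = B'"
  proof (cases "x' = x")
    case True
    then show ?thesis using outer_unique [of x y y'] xy xy' by simp
  next
    case False
    then have "y' = x" using outer_unique [of x' y' x] xy' conn by simp
    moreover have "y = x'" using outer_unique [of x' x y] xy conn False by blast
    ultimately show ?thesis using xy xy' by blast
  qed
qed

lemma gadj_diagram_of: "gadj (diagram_of k M1) (diagram_of k M2) = adj gends G"
  by (simp add: gadj_def adj_def gedges_def diagram_edges_diagram_of m1 m2)

lemma gedges_diagram_of: "gedges (diagram_of k M1) (diagram_of k M2) = G"
  by (simp add: gedges_def diagram_edges_diagram_of m1 m2)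

text \<open>By \<open>outer_unique\<close> a class of connected outer vertices has at most two
  elements.\<close>

lemma diagram_comp_diagram_of:
  "diagram_comp k (diagram_of k M1) (diagram_of k M2) = diagram_of k (outer_edges k G)"
proof -
  let ?V = "diagram_verts k"
  let ?R = "{(x, y). x \<in> ?V \<and> y \<in> ?V \<and> (outer x, outer y) \<in> conn gends G}"
  have edge: "?R `` {x} = {x, y}" if "x \<in> ?V" "y \<in> ?V" "x \<noteq> y" "(outer x, outer y) \<in> conn gends G" for x y
    using that outer_unique [of x y] conn_refl [of "outer x" gends G] by blast
  have sing: "?R `` {x} = {x}" if "x \<in> ?V" "x \<notin> \<Union> (outer_edges k G)" for x
    using that conn_refl [of "outer x" gends G] unfolding outer_edges_def by blast
  have "?V // ?R = diagram_of k (outer_edges k G)"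
  proof (intro equalityI subsetI)
    fix B assume "B \<in> ?V // ?R"
    then obtain x where x: "x \<in> ?V" "B = ?R `` {x}" by (auto simp: quotient_def)
    show "B \<in> diagram_of k (outer_edges k G)"
    proof (cases "x \<in> \<Union> (outer_edges k G)")
      case True
      then obtain C where C: "C \<in> outer_edges k G" "x \<in> C" by blast
      obtain y where y: "C = {x, y}" "x \<noteq> y" "(outer x, outer y) \<in> conn gends G" "x \<in> ?V" "y \<in> ?V"
        using outer_edges_mem [OF C] .
      have "B = C" unfolding x(2) y(1) by (rule edge [OF y(4,5,2,3)])
      then show ?thesis using C(1) unfolding diagram_of_def by blast
    next
      case False
      have "B = {x}" unfolding x(2) by (rule sing [OF x(1) False])
      then show ?thesis using x(1) False unfolding diagram_of_def by blast
    qed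
  next
    fix B assume "B \<in> diagram_of k (outer_edges k G)"
    then consider "B \<in> outer_edges k G" | x where "x \<in> ?V" "x \<notin> \<Union> (outer_edges k G)" "B = {x}"
      by (auto simp: diagram_of_def)
    then show "B \<in> ?V // ?R"
    proof cases
      case 1
      then obtain x y where xy: "x \<in> ?V" "y \<in> ?V" "x \<noteq> y" "(outer x, outer y) \<in> conn gends G"
        and B: "B = {x, y}"
        unfolding outer_edges_def by blast
      show ?thesis unfolding B edge [OF xy, symmetric] by (rule quotientI) (rule xy(1))
    next
      case 2
      have "?R `` {x} = B" unfolding 2(3) by (rule sing [OF 2(1,2)])
      then show ?thesis using quotientI [OF 2(1), of ?R] by (simp only:)
    qed
  qed
  then show ?thesis by (simp add: diagram_comp_def gadj_diagram_of conn_def)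
qed

lemma N1_diagram_of: "N1 k (diagram_of k M1) (diagram_of k M2) = card (loops G)"
proof -
  have "{C \<in> gcomponents k (diagram_of k M1) (diagram_of k M2). C \<subseteq> range Middle \<and>
     (\<exists>vs es. gcycle (diagram_of k M1) (diagram_of k M2) vs es \<and> set vs = C \<and>
        set es = {e \<in> gedges (diagram_of k M1) (diagram_of k M2). gends e \<subseteq> C})} =
     {C \<in> gverts k // conn gends G. C \<subseteq> range Middle \<and>
     (\<exists>vs es. is_cycle gends G vs es \<and> set vs = C \<and> set es = {e \<in> G. gends e \<subseteq> C})}"
    by (simp add: gcomponents_def gadj_diagram_of conn_def gcycle_def is_cycle_def gedges_diagram_of)
  also have "\<dots> = loops G"
  proof (intro equalityI subsetI)
    fix C assume "C \<in> {C \<in> gverts k // conn gends G. C \<subseteq> range Middle \<and>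
      (\<exists>vs es. is_cycle gends G vs es \<and> set vs = C \<and> set es = {e \<in> G. gends e \<subseteq> C})}"
    then have C: "C \<in> gverts k // conn gends G" "C \<subseteq> range Middle"
        "\<exists>vs es. is_cycle gends G vs es \<and> set vs = C \<and> set es = {e \<in> G. gends e \<subseteq> C}"
      by blast+
    obtain u where u: "C = conn gends G `` {u}" using C(1) by (rule quotientE)
    then show "C \<in> loops G"
      using C component_is_cycle_iff [OF u] unfolding loops_def by blast
  next
    fix C assume "C \<in> loops G"
    then obtain u where u: "C = conn gends G `` {u}" and C: "C \<subseteq> range Middle" "\<forall>v\<in>C. degree gends G v = 2"
      unfolding loops_def by blast
    have "u \<in> C" unfolding u by (rule ImageI [OF conn_refl]) simp
    \<comment> \<open>Positive degree makes \<open>u\<close> an endpoint of an edge, hence an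
      element of \<open>gverts k\<close>.\<close>
    then have "degree gends G u \<noteq> 0" using C by simp
    then have "u \<in> gverts k" using degree_pos gends_gverts by blast
    then have "C \<in> gverts k // conn gends G" unfolding u by (rule quotientI)
    then show "C \<in> {C \<in> gverts k // conn gends G. C \<subseteq> range Middle \<and>
      (\<exists>vs es. is_cycle gends G vs es \<and> set vs = C \<and> set es = {e \<in> G. gends e \<subseteq> C})}"
      using C component_is_cycle_iff [OF u] by blast
  qed
  finally show ?thesis by (simp add: N1_def)
qed

end

section \<open>Effect of deleting edges on the composite and the loops\<close>

context gamma_graph
begin

text \<open>Deleting any edge on the path underlying \<open>B\<close> disconnects its ends by
  \<open>bridge\<close>; a component that is not hit stays as it is by
  \<open>component_Diff\<close>.\<close>

lemma outer_edges_Diff: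
  assumes H: "H \<subseteq> G"
  shows "outer_edges k (G - H) = {B \<in> outer_edges k G. block_comp G B \<notin> edge_comp G ` H}"
proof (intro equalityI subsetI)
  fix B assume "B \<in> outer_edges k (G - H)"
  then obtain x y where B: "B = {x, y}" and xy: "x \<in> diagram_verts k" "y \<in> diagram_verts k" "x \<noteq> y"
      and c: "(outer x, outer y) \<in> conn gends (G - H)"
    unfolding outer_edges_def by blast
  have "(outer x, outer y) \<in> conn gends G"
    using c conn_mono [of "G - H" G gends] by blast
  then have oe: "B \<in> outer_edges k G"
    using B xy unfolding outer_edges_def by blast
  have "block_comp G B \<noteq> edge_comp G h" if h: "h \<in> H" for h
  proof
    assume eq: "block_comp G B = edge_comp G h"
    have hG: "h \<in> G" using h H by blast
    have "edge_comp G h = conn gends G `` {outer x}"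
      using block_comp_eq [OF oe, of x] B eq by simp
    then have "gends h \<inter> conn gends G `` {outer x} \<noteq> {}"
      using edge_comp_eq_iff [OF hG] by blast
    then have "(outer x, outer y) \<notin> conn gends (G - {h})"
      by (intro bridge [OF _ degree_outer degree_outer hG]) (simp_all add: xy)
    moreover have "conn gends (G - H) \<subseteq> conn gends (G - {h})"
      using h by (intro conn_mono) blast
    ultimately show False using c by blast
  qed
  then show "B \<in> {B \<in> outer_edges k G. block_comp G B \<notin> edge_comp G ` H}"
    using oe by blast
next
  fix B assume "B \<in> {B \<in> outer_edges k G. block_comp G B \<notin> edge_comp G ` H}"
  then have oe: "B \<in> outer_edges k G" and n: "block_comp G B \<notin> edge_comp G ` H" by blast+
  from oe obtain x y where B: "B = {x, y}" and xy: "x \<in> diagram_verts k" "y \<in> diagram_verts k" "x \<noteq> y"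
      and c: "(outer x, outer y) \<in> conn gends G"
    unfolding outer_edges_def by blast
  have "block_comp G B = conn gends G `` {outer x}"
    using block_comp_eq [OF oe, of x] B by simp
  then have "conn gends (G - H) `` {outer x} = conn gends G `` {outer x}"
    using n edge_comp_eq_iff by (intro component_Diff) (metis IntD1 IntD2 imageI)
  then have "(outer x, outer y) \<in> conn gends (G - H)" using c by blast
  then show "B \<in> outer_edges k (G - H)"
    using B xy unfolding outer_edges_def by blast
qed

text \<open>No new loops arise: a deletion lowers the degree at its endpoints, so a component with
  all degrees two in \<open>G - H\<close> touches no deleted edge and was already a component of
  \<open>G\<close>.\<close>

lemma loops_Diff:
  assumes H: "H \<subseteq> G"
  shows "loops (G - H) = loops G - edge_comp G ` H"
proof (intro equalityI subsetI)
  fix C assume "C \<in> loops (G - H)"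
  then obtain u where u: "C = conn gends (G - H) `` {u}" and C: "C \<subseteq> range Middle"
      and deg: "\<forall>v\<in>C. degree gends (G - H) v = 2"
    unfolding loops_def by blast
  interpret D: multigraph2 gends "G - H" by (rule multigraph2_Diff)
  have same: "{e \<in> G - H. v \<in> gends e} = {e \<in> G. v \<in> gends e}" if "v \<in> C" for v
  proof (rule card_seteq)
    show "card {e \<in> G. v \<in> gends e} \<le> card {e \<in> G - H. v \<in> gends e}"
      using deg that degree_le2 [of v] by (simp add: degree_def)
  qed (use fin in auto)
  have "w \<in> C" if "(u, w) \<in> conn gends G" for w
    using that
  proof (rule component_closed)
    show "u \<in> C" unfolding u by (rule ImageI [OF conn_refl]) simp
    fix e assume e: "e \<in> G" "gends e \<inter> C \<noteq> {}"
    then have "e \<in> G - H" using same by blast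
    then show "gends e \<subseteq> C" unfolding u by (rule D.ends_subset_component) (use e u in blast)
  qed
  moreover have "C \<subseteq> conn gends G `` {u}"
    using conn_mono [of "G - H" G gends] u by blast
  ultimately have uG: "C = conn gends G `` {u}" by blast
  have "degree gends G v = 2" if "v \<in> C" for v
    using deg that unfolding degree_def same [OF that, symmetric] by blast
  then have "C \<in> loops G" using uG C unfolding loops_def by blast
  moreover have "C \<noteq> edge_comp G h" if h: "h \<in> H" for h
  proof
    assume "C = edge_comp G h"
    then have "gends h \<inter> C \<noteq> {}" using edge_comp_eq_iff [of h u] h H uG by blast
    then show False using same h H by blast
  qed
  ultimately show "C \<in> loops G - edge_comp G ` H" by blast
next
  fix C assume C: "C \<in> loops G - edge_comp G ` H"
  then obtain u where u: "C = conn gends G `` {u}" and mid: "C \<subseteq> range Middle"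
      and deg: "\<forall>v\<in>C. degree gends G v = 2"
    unfolding loops_def by blast
  have no: "gends h \<inter> C = {}" if "h \<in> H" for h
    using C u edge_comp_eq_iff [of h u] that H by blast
  then have "conn gends (G - H) `` {u} = conn gends G `` {u}"
    using u by (intro component_Diff) blast
  moreover have "degree gends (G - H) v = 2" if "v \<in> C" for v
  proof -
    have "{e \<in> G - H. v \<in> gends e} = {e \<in> G. v \<in> gends e}" using no that by blast
    then show ?thesis using deg that by (simp add: degree_def)
  qed
  ultimately show "C \<in> loops (G - H)" using u mid unfolding loops_def by blast
qed

text \<open>A loop stays in the middle row, so its edges are caps of the upper or cups of the lower
  diagram. Loops are therefore deletable in (b) as well as in (a).\<close>

lemma loops_are_edge_comps:
  assumes "C \<in> loops G"
  obtains e where "e \<in> G" "ghorizontal e" "C = edge_comp G e"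
proof -
  from assms obtain u where u: "C = conn gends G `` {u}" and mid: "C \<subseteq> range Middle"
      and deg: "\<forall>v\<in>C. degree gends G v = 2"
    unfolding loops_def by blast
  have "u \<in> C" unfolding u by (rule ImageI [OF conn_refl]) simp
  then have "degree gends G u \<noteq> 0" using deg by simp
  then obtain e where e: "e \<in> G" "u \<in> gends e" using degree_pos by blast
  have C: "C = edge_comp G e" using edge_comp_eq [OF e] u by simp
  have "gends e \<subseteq> C" unfolding C edge_comp_def by (blast intro: ImageI [OF conn_refl])
  then have ends: "gends e \<subseteq> range Middle" using mid by blast
  from e(1) have "ghorizontal e"
  proof (elim PlusE)
    fix B assume B: "e = Inl B" "B \<in> M1"
    have "x \<in> range Inr" if "x \<in> B" for x using ends that B by (cases x) auto
    then show ?thesis using B matching_card [OF m1] by (auto simp: is_horizontal_def is_cap_def)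
  next
    fix B assume B: "e = Inr B" "B \<in> M2"
    have "x \<in> range Inl" if "x \<in> B" for x using ends that B by (cases x) auto
    then show ?thesis using B matching_card [OF m2] by (auto simp: is_horizontal_def is_cup_def)
  qed
  then show thesis using that e(1) C by blast
qed

lemma finite_loops: "finite (loops G)"
proof (rule finite_subset)
  show "loops G \<subseteq> edge_comp G ` G" by (rule subsetI) (erule loops_are_edge_comps, blast)
qed (use finite_G in simp)

lemma block_comp_not_loop: "B \<in> outer_edges k G \<Longrightarrow> block_comp G B \<notin> loops G"
proof
  assume B: "B \<in> outer_edges k G" and L: "block_comp G B \<in> loops G"
  from B obtain x where "x \<in> B" unfolding outer_edges_def by blast
  then have "outer x \<in> block_comp G B" unfolding block_comp_def by (intro ImageI [OF conn_refl]) simp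
  then show False using L unfolding loops_def by (cases x) auto
qed

end

section \<open>Multiplication in the partial Brauer algebra\<close>

lemma PB_simps [simp]:
  "zero (PB k \<delta> \<delta>') = 0" "add (PB k \<delta> \<delta>') = (+)"
  "one (PB k \<delta> \<delta>') = pb_basis (id_diagram k)"
  by (simp_all add: PB_def)

lemma lookup_PB_smult: "Poly_Mapping.lookup (c \<odot>\<^bsub>PB k \<delta> \<delta>'\<^esub> x) d = c * Poly_Mapping.lookup x d"
  by (simp add: PB_def map.rep_eq when_def)

lemma PB_smult_single [simp]:
  "c \<odot>\<^bsub>PB k \<delta> \<delta>'\<^esub> Poly_Mapping.single d a = Poly_Mapping.single d (c * a)"
  by (rule poly_mapping_eqI) (simp add: lookup_PB_smult lookup_single when_def)

lemma PB_smult_add: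
  "c \<odot>\<^bsub>PB k \<delta> \<delta>'\<^esub> (x + y) = c \<odot>\<^bsub>PB k \<delta> \<delta>'\<^esub> x + c \<odot>\<^bsub>PB k \<delta> \<delta>'\<^esub> y"
  by (rule poly_mapping_eqI) (simp add: lookup_PB_smult lookup_add algebra_simps)

text \<open>The product sums over supports, which vary under addition. Over a common finite superset
  the extra terms vanish, and bilinearity becomes a termwise statement.\<close>

lemma PB_mult_superset:
  assumes "finite A" "Poly_Mapping.keys x \<subseteq> A" "finite B" "Poly_Mapping.keys y \<subseteq> B"
  shows "x \<otimes>\<^bsub>PB k \<delta> \<delta>'\<^esub> y = (\<Sum>d1\<in>A. \<Sum>d2\<in>B. Poly_Mapping.single (diagram_comp k d1 d2)
    (Poly_Mapping.lookup x d1 * Poly_Mapping.lookup y d2 * (\<delta> ^ N1 k d1 d2 * \<delta>' ^ N2 k d1 d2)))"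
proof -
  let ?f = "\<lambda>d1 d2. Poly_Mapping.single (diagram_comp k d1 d2)
    (Poly_Mapping.lookup x d1 * Poly_Mapping.lookup y d2 * (\<delta> ^ N1 k d1 d2 * \<delta>' ^ N2 k d1 d2))"
  have "(\<Sum>d1\<in>A. \<Sum>d2\<in>B. ?f d1 d2) = (\<Sum>d1\<in>A. \<Sum>d2\<in>Poly_Mapping.keys y. ?f d1 d2)"
    using assms by (intro sum.cong sum.mono_neutral_right) (auto simp: in_keys_iff)
  also have "\<dots> = (\<Sum>d1\<in>Poly_Mapping.keys x. \<Sum>d2\<in>Poly_Mapping.keys y. ?f d1 d2)"
    using assms by (intro sum.mono_neutral_right) (auto simp: in_keys_iff)
  finally show ?thesis by (simp add: PB_def)
qed

lemma PB_mult_add_left: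
  "(x + x') \<otimes>\<^bsub>PB k \<delta> \<delta>'\<^esub> y = x \<otimes>\<^bsub>PB k \<delta> \<delta>'\<^esub> y + x' \<otimes>\<^bsub>PB k \<delta> \<delta>'\<^esub> y"
proof -
  let ?A = "Poly_Mapping.keys x \<union> Poly_Mapping.keys x'"
  have "Poly_Mapping.keys (x + x') \<subseteq> ?A" by (rule keys_add)
  then show ?thesis
    by (simp add: PB_mult_superset [of ?A _ "Poly_Mapping.keys y"] lookup_add distrib_right
        single_add sum.distrib)
qed

lemma PB_mult_add_right:
  "x \<otimes>\<^bsub>PB k \<delta> \<delta>'\<^esub> (y + y') = x \<otimes>\<^bsub>PB k \<delta> \<delta>'\<^esub> y + x \<otimes>\<^bsub>PB k \<delta> \<delta>'\<^esub> y'"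
proof -
  let ?B = "Poly_Mapping.keys y \<union> Poly_Mapping.keys y'"
  have "Poly_Mapping.keys (y + y') \<subseteq> ?B" by (rule keys_add)
  then show ?thesis
    by (simp add: PB_mult_superset [of "Poly_Mapping.keys x" _ ?B] lookup_add distrib_right
        distrib_left single_add sum.distrib)
qed

lemma PB_mult_basis:
  "pb_basis d1 \<otimes>\<^bsub>PB k \<delta> \<delta>'\<^esub> pb_basis d2 =
     Poly_Mapping.single (diagram_comp k d1 d2) (\<delta> ^ N1 k d1 d2 * \<delta>' ^ N2 k d1 d2)"
  by (simp add: PB_mult_superset [of "{d1}" _ "{d2}"])

lemma PB_mult_alt_sum:
  "alt_sum A f \<otimes>\<^bsub>PB k \<delta> \<delta>'\<^esub> alt_sum B g =
     alt_sum A (\<lambda>S. alt_sum B (\<lambda>T. f S \<otimes>\<^bsub>PB k \<delta> \<delta>'\<^esub> g T))"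
proof -
  have "alt_sum A f \<otimes>\<^bsub>PB k \<delta> \<delta>'\<^esub> alt_sum B g = alt_sum A (\<lambda>S. f S \<otimes>\<^bsub>PB k \<delta> \<delta>'\<^esub> alt_sum B g)"
    by (rule additive_alt_sum) (rule PB_mult_add_left)
  also have "\<dots> = alt_sum A (\<lambda>S. alt_sum B (\<lambda>T. f S \<otimes>\<^bsub>PB k \<delta> \<delta>'\<^esub> g T))"
    by (intro alt_sum_cong refl additive_alt_sum) (rule PB_mult_add_right)
  finally show ?thesis .
qed

text \<open>\<open>E\<close> holds the deletable edges. \<open>E = M\<close> gives
  \<open>pb_bar\<close>, the horizontal edges give \<open>pb_tilde\<close>, the empty set gives a
  basis element, and one edge of the identity diagram gives some 1 - p_i.\<close>

definition edge_sum :: "nat \<Rightarrow> diagram \<Rightarrow> diagram \<Rightarrow> diagram \<Rightarrow>\<^sub>0 'a::{comm_ring,comm_monoid_mult}" where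
  "edge_sum k M E = alt_sum E (\<lambda>H. pb_basis (diagram_of k (M - H)))"

context gamma_graph
begin

lemma finite_subgraph:
  assumes "E1 \<subseteq> M1" "E2 \<subseteq> M2"
  shows "finite E1" "finite E2"
  by (rule finite_subset [OF assms(1) finite_matching [OF m1]])
    (rule finite_subset [OF assms(2) finite_matching [OF m2]])

text \<open>Both double sums merge into one over subsets of \<open>E1 <+> E2\<close>, which
  \<open>alt_sum_image\<close> pushes forward along \<open>edge_comp\<close>. The second parameter
  being 1, paths in the middle row contribute no factor.\<close>

lemma edge_sum_mult:
  fixes \<delta> :: "'a::{comm_ring,comm_monoid_mult}"
  assumes E: "E1 \<subseteq> M1" "E2 \<subseteq> M2"
  shows "edge_sum k M1 E1 \<otimes>\<^bsub>PB k \<delta> 1\<^esub> edge_sum k M2 E2 =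
    alt_sum (edge_comp G ` (E1 <+> E2)) (\<lambda>T. Poly_Mapping.single
      (diagram_of k {B \<in> outer_edges k G. block_comp G B \<notin> T}) (\<delta> ^ card (loops G - T)))"
    (is "_ = alt_sum _ ?g")
proof -
  have "pb_basis (diagram_of k (M1 - S)) \<otimes>\<^bsub>PB k \<delta> 1\<^esub> pb_basis (diagram_of k (M2 - T)) =
      ?g (edge_comp G ` (S <+> T))" if "S \<subseteq> E1" "T \<subseteq> E2" for S T
  proof -
    interpret D: gamma_graph k "M1 - S" "M2 - T"
      by standard (intro matching_Diff m1 m2)+
    have eq: "(M1 - S) <+> (M2 - T) = G - (S <+> T)" by auto
    have sub: "S <+> T \<subseteq> G" using that E by auto
    show ?thesis
      by (simp add: PB_mult_basis D.diagram_comp_diagram_of D.N1_diagram_of eq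
          outer_edges_Diff [OF sub] loops_Diff [OF sub])
  qed
  then have "edge_sum k M1 E1 \<otimes>\<^bsub>PB k \<delta> 1\<^esub> edge_sum k M2 E2 =
      alt_sum E1 (\<lambda>S. alt_sum E2 (\<lambda>T. ?g (edge_comp G ` (S <+> T))))"
    unfolding edge_sum_def PB_mult_alt_sum by (intro alt_sum_cong refl)
  also have "\<dots> = alt_sum (E1 <+> E2) (\<lambda>H. ?g (edge_comp G ` H))"
    by (rule alt_sum_Plus [symmetric]) (rule finite_subgraph [OF E])+
  also have "\<dots> = alt_sum (edge_comp G ` (E1 <+> E2)) ?g"
    by (rule alt_sum_image) (use finite_subgraph [OF E] in simp)
  finally show ?thesis .
qed

text \<open>Hitting the component of \<open>e\<close> changes neither the loops nor the composite,
  so toggling it cancels everything.\<close>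

lemma edge_sum_mult_0:
  assumes E: "E1 \<subseteq> M1" "E2 \<subseteq> M2" and e: "e \<in> E1 <+> E2"
    and "edge_comp G e \<notin> loops G" "edge_comp G e \<notin> block_comp G ` outer_edges k G"
  shows "edge_sum k M1 E1 \<otimes>\<^bsub>PB k \<delta> 1\<^esub> edge_sum k M2 E2 = 0"
  unfolding edge_sum_mult [OF E]
proof (rule alt_sum_absorb)
  show "finite (edge_comp G ` (E1 <+> E2))"
    using finite_subgraph [OF E] by simp
  show "edge_comp G e \<in> edge_comp G ` (E1 <+> E2)" using e by (rule imageI)
  fix T
  have "loops G - insert (edge_comp G e) T = loops G - T"
    using assms(4) by blast
  moreover have "{B \<in> outer_edges k G. block_comp G B \<notin> insert (edge_comp G e) T} =
      {B \<in> outer_edges k G. block_comp G B \<notin> T}"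
    using assms(5) by (metis (no_types, lifting) image_eqI insert_iff)
  ultimately show "Poly_Mapping.single
      (diagram_of k {B \<in> outer_edges k G. block_comp G B \<notin> insert (edge_comp G e) T})
      (\<delta> ^ card (loops G - insert (edge_comp G e) T)) = Poly_Mapping.single
      (diagram_of k {B \<in> outer_edges k G. block_comp G B \<notin> T}) (\<delta> ^ card (loops G - T))"
    by (simp only:)
qed

text \<open>The components hit are loops or carry an edge of the composite, and the two kinds are
  disjoint, so the sum factorises. \<open>L\<close> is essential: a loop without a deletable edge
  would contribute \<delta> instead of \<delta> - 1.\<close>

lemma edge_sum_mult_good:
  assumes E: "E1 \<subseteq> M1" "E2 \<subseteq> M2" and L: "loops G \<subseteq> edge_comp G ` (E1 <+> E2)"
    and good: "\<And>e. e \<in> E1 <+> E2 \<Longrightarrow> edge_comp G e \<notin> loops G \<Longrightarrow>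
      edge_comp G e \<in> block_comp G ` outer_edges k G"
  shows "edge_sum k M1 E1 \<otimes>\<^bsub>PB k \<delta> 1\<^esub> edge_sum k M2 E2 =
    (\<delta> - 1) ^ card (loops G) \<odot>\<^bsub>PB k \<delta> 1\<^esub>
      edge_sum k (outer_edges k G) {B \<in> outer_edges k G. block_comp G B \<in> edge_comp G ` (E1 <+> E2)}"
    (is "_ = _ \<odot>\<^bsub>_\<^esub> edge_sum k ?M ?E")
proof -
  let ?g = "\<lambda>T. Poly_Mapping.single (diagram_of k {B \<in> ?M. block_comp G B \<notin> T}) (\<delta> ^ card (loops G - T))"
  have finE: "finite ?E" using finite_matching [OF matching_outer_edges] by simp
  have "edge_comp G ` (E1 <+> E2) = block_comp G ` ?E \<union> loops G"
  proof (intro equalityI subsetI)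
    fix C assume C: "C \<in> edge_comp G ` (E1 <+> E2)"
    then obtain e where e: "e \<in> E1 <+> E2" "C = edge_comp G e" by (rule imageE)
    show "C \<in> block_comp G ` ?E \<union> loops G"
    proof (cases "C \<in> loops G")
      case False
      then have "C \<in> block_comp G ` ?M" using good [OF e(1)] e(2) by simp
      then obtain B where "B \<in> ?M" "C = block_comp G B" by (rule imageE)
      then show ?thesis using C by (intro UnI1 image_eqI [of _ _ B]) simp_all
    qed simp
  next
    fix C assume "C \<in> block_comp G ` ?E \<union> loops G"
    then show "C \<in> edge_comp G ` (E1 <+> E2)" using L by fast
  qed
  then have "edge_sum k M1 E1 \<otimes>\<^bsub>PB k \<delta> 1\<^esub> edge_sum k M2 E2 = alt_sum (block_comp G ` ?E \<union> loops G) ?g"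
    by (simp only: edge_sum_mult [OF E])
  also have "\<dots> = alt_sum (block_comp G ` ?E) (\<lambda>S. alt_sum (loops G) (\<lambda>T. ?g (S \<union> T)))"
    using finE finite_loops block_comp_not_loop by (intro alt_sum_Un) auto
  also have "\<dots> = alt_sum ?E (\<lambda>S. alt_sum (loops G) (\<lambda>T. ?g (block_comp G ` S \<union> T)))"
    using finE by (rule alt_sum_image [symmetric])
  also have "\<dots> = alt_sum ?E (\<lambda>S. (\<delta> - 1) ^ card (loops G) \<odot>\<^bsub>PB k \<delta> 1\<^esub> pb_basis (diagram_of k (?M - S)))"
  proof (rule alt_sum_cong [OF refl])
    fix S assume S: "S \<subseteq> ?E"
    \<comment> \<open>The factor \<open>1\<close> is the constant \<open>c\<close> of
      \<open>alt_sum_power\<close>.\<close>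
    have "?g (block_comp G ` S \<union> T) = Poly_Mapping.single (diagram_of k (?M - S)) (1 * \<delta> ^ card (loops G - T))"
      if T: "T \<subseteq> loops G" for T
    proof -
      have SM: "S \<subseteq> ?M" using S by blast
      have "block_comp G B \<in> block_comp G ` S \<union> T \<longleftrightarrow> B \<in> S" if "B \<in> ?M" for B
        using inj_on_image_mem_iff [OF inj_block_comp that SM] block_comp_not_loop [OF that] T by auto
      then have "{B \<in> ?M. block_comp G B \<notin> block_comp G ` S \<union> T} = ?M - S" by blast
      moreover have "loops G \<inter> block_comp G ` S = {}"
        using SM block_comp_not_loop by auto
      then have "loops G - (block_comp G ` S \<union> T) = loops G - T" by blast
      ultimately show ?thesis by simp
    qed
    then have "alt_sum (loops G) (\<lambda>T. ?g (block_comp G ` S \<union> T)) =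
        alt_sum (loops G) (\<lambda>T. Poly_Mapping.single (diagram_of k (?M - S)) (1 * \<delta> ^ card (loops G - T)))"
      by (rule alt_sum_cong [OF refl])
    also have "\<dots> = Poly_Mapping.single (diagram_of k (?M - S)) (1 * (\<delta> - 1) ^ card (loops G))"
      unfolding alt_sum_power [OF finite_loops, symmetric]
      by (rule additive_alt_sum [symmetric]) (rule single_add)
    finally show "alt_sum (loops G) (\<lambda>T. ?g (block_comp G ` S \<union> T)) =
        (\<delta> - 1) ^ card (loops G) \<odot>\<^bsub>PB k \<delta> 1\<^esub> pb_basis (diagram_of k (?M - S))"
      by simp
  qed
  also have "\<dots> = (\<delta> - 1) ^ card (loops G) \<odot>\<^bsub>PB k \<delta> 1\<^esub> edge_sum k ?M ?E"
    unfolding edge_sum_def by (rule additive_alt_sum [symmetric]) (rule PB_smult_add)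
  finally show ?thesis .
qed

end

section \<open>The two families of basis elements as alternating sums\<close>

text \<open>Each edge merges two vertices into one block. Hence the exponent in
  \<open>pb_bar\<close> is the number of deleted edges.\<close>

lemma card_diagram_of:
  assumes "matching k M"
  shows "card (diagram_of k M) + card M = card (diagram_verts k)"
proof -
  let ?V = "diagram_verts k"
  have sub: "\<Union>M \<subseteq> ?V" using assms by (auto simp: matching_def)
  have disj: "M \<inter> (\<lambda>x. {x}) ` (?V - \<Union>M) = {}" by auto
  have "card (\<Union>M) = (\<Sum>B\<in>M. card B)"
    using assms finite_subset [OF _ finite_diagram_verts]
    by (intro card_Union_disjoint) (auto simp: matching_def disjoint_def pairwise_def disjnt_def)
  then have "card (\<Union>M) = 2 * card M"
    using assms by (simp add: matching_def)
  moreover have "card (?V - \<Union>M) = card ?V - card (\<Union>M)"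
    using sub by (intro card_Diff_subset finite_subset [OF sub]) simp_all
  moreover have "card (\<Union>M) \<le> card ?V" using sub by (intro card_mono) auto
  moreover have "card (diagram_of k M) = card M + card (?V - \<Union>M)"
    unfolding diagram_of_def using finite_matching [OF assms] disj
    by (subst card_Un_disjoint) (simp_all add: card_image)
  ultimately show ?thesis by linarith
qed

text \<open>A block of size two in the refinement fills the block that contains it, so it is an edge
  of \<open>M\<close>.\<close>

lemma refines_iff:
  assumes "matching k M"
  shows "refines (diagram_verts k) d' (diagram_of k M) \<longleftrightarrow> (\<exists>N\<subseteq>M. d' = diagram_of k N)"
proof
  let ?V = "diagram_verts k"
  have pb: "diagram_of k M \<in> pb_diagrams k" by (rule diagram_of_in_pb [OF assms])
  assume "refines ?V d' (diagram_of k M)"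
  then have part: "partition_on ?V d'" and ref: "\<And>X. X \<in> d' \<Longrightarrow> \<exists>Y\<in>diagram_of k M. X \<subseteq> Y"
    by (auto simp: refines_def)
  have block: "finite Y \<and> card Y \<le> 2" if "Y \<in> diagram_of k M" for Y
    using pb that by (auto simp: pb_diagrams_def partition_on_def intro: finite_subset [OF _ finite_diagram_verts])
  have "card X \<le> 2" if "X \<in> d'" for X
    using ref [OF that] block by (meson card_mono le_trans)
  then have d': "d' \<in> pb_diagrams k" using part by (simp add: pb_diagrams_def)
  have "diagram_edges d' \<subseteq> M"
  proof
    fix X assume X: "X \<in> diagram_edges d'"
    then have X2: "card X = 2" "X \<in> d'" by (auto simp: diagram_edges_def)
    then obtain Y where Y: "Y \<in> diagram_of k M" "X \<subseteq> Y" using ref by blast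
    then have "X = Y" using block [of Y] X2 by (intro card_seteq) auto
    then have "X \<in> diagram_edges (diagram_of k M)" using Y X2 by (simp add: diagram_edges_def)
    then show "X \<in> M" by (simp add: diagram_edges_diagram_of assms)
  qed
  then show "\<exists>N\<subseteq>M. d' = diagram_of k N"
    using diagram_of_diagram_edges [OF d'] by metis
next
  assume "\<exists>N\<subseteq>M. d' = diagram_of k N"
  then obtain N where N: "N \<subseteq> M" "d' = diagram_of k N" by blast
  have "\<exists>Y\<in>diagram_of k M. X \<subseteq> Y" if X: "X \<in> diagram_of k N" for X
  proof (cases "X \<in> N")
    case False
    then obtain x where "X = {x}" "x \<in> diagram_verts k" using X by (auto simp: diagram_of_def)
    then show ?thesis unfolding diagram_of_def by blast
  qed (use N in \<open>auto simp: diagram_of_def\<close>)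
  moreover have "diagram_of k N \<in> pb_diagrams k" "diagram_of k M \<in> pb_diagrams k"
    using assms N matching_mono by (blast intro: diagram_of_in_pb)+
  ultimately show "refines (diagram_verts k) d' (diagram_of k M)"
    using N by (simp add: refines_def pb_diagrams_def)
qed

lemma single_minus_one_power:
  "Poly_Mapping.single d ((- 1) ^ n) = (if even n then pb_basis d else - pb_basis d
    :: diagram \<Rightarrow>\<^sub>0 'a::{comm_ring,comm_monoid_mult})"
proof -
  have "(- 1) ^ n = (if even n then 1 else - 1 :: 'a)"
    by (induction n) auto
  then show ?thesis by (simp add: single_uminus)
qed

lemma pb_bar_eq:
  assumes "matching k M"
  shows "pb_bar k (diagram_of k M) = edge_sum k M M"
  unfolding pb_bar_def edge_sum_def alt_sum_def
proof (rule sum.reindex_bij_witness [where i = "\<lambda>H. diagram_of k (M - H)" and j = "\<lambda>d'. M - diagram_edges d'"])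
  fix d' assume "d' \<in> {d'. refines (diagram_verts k) d' (diagram_of k M)}"
  then obtain N where N: "N \<subseteq> M" "d' = diagram_of k N"
    using refines_iff [OF assms] by auto
  have m: "matching k N" using matching_mono [OF assms N(1)] .
  have e: "diagram_edges d' = N" using N diagram_edges_diagram_of [OF m] by simp
  have MN: "M - (M - N) = N" using N by blast
  show "diagram_of k (M - (M - diagram_edges d')) = d'" using N e MN by simp
  show "M - diagram_edges d' \<in> Pow M" by blast
  have "card (M - N) = card M - card N" "card N \<le> card M"
    using N finite_matching [OF assms] finite_matching [OF m] by (auto intro: card_Diff_subset card_mono)
  then have "card d' - card (diagram_of k M) = card (M - N)"
    using card_diagram_of [OF assms] card_diagram_of [OF m] N e by simp
  then show "(if even (card (M - diagram_edges d')) then pb_basis (diagram_of k (M - (M - diagram_edges d')))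
      else - pb_basis (diagram_of k (M - (M - diagram_edges d')))) =
      Poly_Mapping.single d' ((- 1) ^ (card d' - card (diagram_of k M)))"
    by (simp only: single_minus_one_power e MN N(2) [symmetric])
next
  fix H assume H: "H \<in> Pow M"
  show "diagram_of k (M - H) \<in> {d'. refines (diagram_verts k) d' (diagram_of k M)}"
    using refines_iff [OF assms] by blast
  show "M - diagram_edges (diagram_of k (M - H)) = H"
    using H by (simp add: diagram_edges_diagram_of [OF matching_Diff [OF assms]] double_diff)
qed

section \<open>Multiplication by the elements 1 - p_i\<close>

lemma PB_smult_one: "1 \<odot>\<^bsub>PB k \<delta> \<delta>'\<^esub> x = x"
  by (rule poly_mapping_eqI) (simp add: lookup_PB_smult)

text \<open>If one of the two diagrams is the identity, then \<open>\<phi>\<close> retracts \<open>\<Gamma>\<close> onto the other one, whose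
  edges are \<open>M\<close>.\<close>

lemma (in gamma_graph) edge_sum_mult_retract:
  assumes M: "matching k M"
    and outer: "\<And>x. \<phi> (outer x) = x"
    and conn: "\<And>v. v \<in> gverts k \<Longrightarrow> (v, outer (\<phi> v)) \<in> conn gends G"
    and edge: "\<And>e. e \<in> G \<Longrightarrow> \<phi> ` gends e \<in> M \<or> (\<exists>x. \<phi> ` gends e = {x})"
    and ex: "\<And>B. B \<in> M \<Longrightarrow> \<exists>e\<in>G. \<phi> ` gends e = B"
    and E: "E1 \<subseteq> M1" "E2 \<subseteq> M2"
    and meet: "\<And>e. e \<in> E1 <+> E2 \<Longrightarrow> \<exists>B\<in>M. \<phi> ` gends e \<inter> B \<noteq> {}"
  shows "edge_sum k M1 E1 \<otimes>\<^bsub>PB k \<delta> 1\<^esub> edge_sum k M2 E2 =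
    edge_sum k M {B \<in> M. \<exists>e\<in>E1 <+> E2. \<phi> ` gends e \<inter> B \<noteq> {}}"
proof -
  \<comment> \<open>A walk in \<Gamma> projects to a walk in the matching \<open>M\<close>, which
    cannot leave a single edge.\<close>
  have conn_phi: "\<phi> u = \<phi> v \<or> {\<phi> u, \<phi> v} \<in> M" if "(u, v) \<in> conn gends G" for u v
    using that unfolding conn_def
  proof (induction rule: rtrancl_induct)
    case (step v w)
    then obtain e where e: "e \<in> G" "gends e = {v, w}" by (auto simp: adj_def)
    have vw: "\<phi> v = \<phi> w \<or> {\<phi> v, \<phi> w} \<in> M" using edge [OF e(1)] e(2) by auto
    show ?case
    proof (cases "\<phi> u = \<phi> v \<or> \<phi> v = \<phi> w")
      case True
      then show ?thesis using vw step.IH by auto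
    next
      case False
      then have "{\<phi> u, \<phi> v} = {\<phi> v, \<phi> w}"
        using vw step.IH matching_unique [OF M, of "{\<phi> u, \<phi> v}" "{\<phi> v, \<phi> w}" "\<phi> v"] by auto
      then show ?thesis using False by (auto simp: doubleton_eq_iff)
    qed
  qed simp
  have oe: "outer_edges k G = M"
  proof (intro equalityI subsetI)
    fix B assume "B \<in> outer_edges k G"
    then obtain x y where "B = {x, y}" "x \<noteq> y" "(outer x, outer y) \<in> conn gends G"
      unfolding outer_edges_def by blast
    then show "B \<in> M" using conn_phi [of "outer x" "outer y"] outer by simp
  next
    fix B assume B: "B \<in> M"
    then obtain e where e: "e \<in> G" "\<phi> ` gends e = B" using ex by blast
    obtain u v where uv: "gends e = {u, v}" using obtain_ends [OF e(1)] by blast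
    then have Beq: "B = {\<phi> u, \<phi> v}" using e by auto
    then have ne: "\<phi> u \<noteq> \<phi> v" using matching_card [OF M B] by auto
    have "u \<in> gverts k" "v \<in> gverts k" using gends_gverts [OF e(1)] uv by auto
    then have "(outer (\<phi> u), outer (\<phi> v)) \<in> conn gends G"
      using conn conn_ends [OF e(1), of u v] uv by (blast intro: conn_sym conn_trans)
    moreover have "\<phi> u \<in> diagram_verts k" "\<phi> v \<in> diagram_verts k"
      using matching_verts [OF M B] Beq by auto
    ultimately show "B \<in> outer_edges k G"
      unfolding outer_edges_def using Beq ne by blast
  qed
  \<comment> \<open>Every vertex is connected to the outer vertex onto which it retracts, so no
    component stays in the middle row.\<close>
  have no_loops: "loops G = {}"
  proof (rule ccontr)
    assume "loops G \<noteq> {}"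
    then obtain u where mid: "conn gends G `` {u} \<subseteq> range Middle"
        and deg: "\<forall>v\<in>conn gends G `` {u}. degree gends G v = 2"
      unfolding loops_def by blast
    have "degree gends G u = 2" using deg by (rule bspec) (rule ImageI [OF conn_refl], simp)
    then have "u \<in> gverts k" using degree_pos [of u] gends_gverts by force
    then have "outer (\<phi> u) \<in> range Middle" using conn mid by blast
    then show False by (cases "\<phi> u") auto
  qed
  have comp: "edge_comp G e = block_comp G B" if e: "e \<in> G" and B: "B \<in> M" "\<phi> ` gends e \<inter> B \<noteq> {}" for e B
  proof -
    obtain v where v: "v \<in> gends e" "\<phi> v \<in> B" using B by blast
    have "v \<in> gverts k" using gends_gverts [OF e] v by blast
    then have "(v, outer (\<phi> v)) \<in> conn gends G" by (rule conn)
    then have "conn gends G `` {v} = conn gends G `` {outer (\<phi> v)}"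
      by (intro component_eq [symmetric]) simp
    then show ?thesis
      using edge_comp_eq [OF e v(1)] block_comp_eq [of B "\<phi> v"] B v(2) oe by simp
  qed
  have EG: "e \<in> G" if "e \<in> E1 <+> E2" for e using that E by auto
  have "{B \<in> M. block_comp G B \<in> edge_comp G ` (E1 <+> E2)} =
      {B \<in> M. \<exists>e\<in>E1 <+> E2. \<phi> ` gends e \<inter> B \<noteq> {}}"
  proof (intro Collect_cong conj_cong refl iffI)
    fix B assume B: "B \<in> M"
    {
      assume "block_comp G B \<in> edge_comp G ` (E1 <+> E2)"
      then obtain e where e: "e \<in> E1 <+> E2" "block_comp G B = edge_comp G e" by (rule imageE)
      obtain B' where B': "B' \<in> M" "\<phi> ` gends e \<inter> B' \<noteq> {}" using meet [OF e(1)] by blast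
      then have "block_comp G B = block_comp G B'" using comp [OF EG [OF e(1)]] e(2) by simp
      then have "B = B'" using inj_onD [OF inj_block_comp] B B'(1) oe by simp
      then show "\<exists>e\<in>E1 <+> E2. \<phi> ` gends e \<inter> B \<noteq> {}" using e B' by blast
    next
      assume "\<exists>e\<in>E1 <+> E2. \<phi> ` gends e \<inter> B \<noteq> {}"
      then obtain e where e: "e \<in> E1 <+> E2" "\<phi> ` gends e \<inter> B \<noteq> {}" by blast
      then have "block_comp G B = edge_comp G e" using comp [OF EG] B by simp
      then show "block_comp G B \<in> edge_comp G ` (E1 <+> E2)" using e(1) by (rule image_eqI)
    }
  qed
  moreover have "edge_comp G e \<in> block_comp G ` M" if "e \<in> E1 <+> E2" for e
    using meet [OF that] comp [OF EG [OF that]] by blast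
  ultimately show ?thesis
    using edge_sum_mult_good [OF E] by (simp add: oe no_loops PB_smult_one)
qed

text \<open>The rungs over \<open>{1..k}\<close> are the edges of the identity diagram; removing the
  rung at \<open>i\<close> yields \<open>p_diagram k i\<close>.\<close>

definition rungs :: "nat set \<Rightarrow> diagram" where
  "rungs A = (\<lambda>i. {Inl i, Inr i}) ` A"

lemma matching_rungs: "matching k (rungs {1..k})"
  by (auto simp: matching_def disjoint_def rungs_def)

text \<open>Deleting the rung at \<open>i\<close> has the same effect as deleting the edge of
  \<open>M\<close> at the top vertex \<open>i\<close>, so this edge becomes deletable. Were
  \<open>i\<close> isolated there, the product would be 0, whence the condition on
  \<open>A\<close>.\<close>

lemma edge_sum_rungs_left:
  assumes M: "matching k M" and A: "\<And>i. i \<in> A \<Longrightarrow> Inl i \<in> \<Union>M" and E: "E \<subseteq> M"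
  shows "edge_sum k (rungs {1..k}) (rungs A) \<otimes>\<^bsub>PB k \<delta> 1\<^esub> edge_sum k M E =
    edge_sum k M (E \<union> {B \<in> M. \<exists>i\<in>A. Inl i \<in> B})"
proof -
  interpret gamma_graph k "rungs {1..k}" M
    by standard (rule matching_rungs M)+
  \<comment> \<open>The rungs occupy the upper half, so each middle vertex is contracted to the
    vertex above it.\<close>
  define \<phi> :: "gvertex \<Rightarrow> nat + nat" where "\<phi> = case_gvertex Inl Inl Inr"
  have rung: "\<phi> ` gends (Inl {Inl i, Inr i}) = {Inl i}" for i
    by (auto simp: \<phi>_def)
  have "\<phi> (case_sum Middle Lower x) = x" for x
    by (cases x) (auto simp: \<phi>_def)
  then have edge: "\<phi> ` gends (Inr B) = B" for B
    by (simp add: image_image)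
  have A': "i \<in> {1..k}" if "i \<in> A" for i
    using A [OF that] matching_verts [OF M] by (auto dest: matching_verts [OF M])
  have "edge_sum k (rungs {1..k}) (rungs A) \<otimes>\<^bsub>PB k \<delta> 1\<^esub> edge_sum k M E =
      edge_sum k M {B \<in> M. \<exists>e\<in>rungs A <+> E. \<phi> ` gends e \<inter> B \<noteq> {}}"
  proof (rule edge_sum_mult_retract [OF M])
    show "\<phi> (outer x) = x" for x
      by (cases x) (auto simp: \<phi>_def)
    show "(v, outer (\<phi> v)) \<in> conn gends G" if "v \<in> gverts k" for v
    proof (cases v)
      case (Middle i)
      then have "i \<in> {1..k}" using that by (auto simp: gverts_def)
      then have "Inl {Inl i, Inr i} \<in> G" by (auto simp: rungs_def)
      then have "(Middle i, Upper i) \<in> conn gends G" by (rule conn_ends) auto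
      then show ?thesis using Middle by (simp add: \<phi>_def)
    qed (auto simp: \<phi>_def)
    show "\<phi> ` gends e \<in> M \<or> (\<exists>x. \<phi> ` gends e = {x})" if "e \<in> G" for e
      using that rung edge by (auto simp: rungs_def simp del: gends.simps)
    show "\<exists>e\<in>G. \<phi> ` gends e = B" if "B \<in> M" for B
      using that edge by (intro bexI [of _ "Inr B"]) auto
    show "rungs A \<subseteq> rungs {1..k}" using A' unfolding rungs_def by blast
    show "\<exists>B\<in>M. \<phi> ` gends e \<inter> B \<noteq> {}" if "e \<in> rungs A <+> E" for e
      using that
    proof (elim PlusE)
      fix a assume "e = Inl a" "a \<in> rungs A"
      then show ?thesis using A rung by (auto simp: rungs_def simp del: gends.simps)
    next
      fix B assume B: "e = Inr B" "B \<in> E"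
      then have "B \<in> M" "B \<noteq> {}" using E matching_card [OF M, of B] by auto
      then show ?thesis using edge [of B] B by (intro bexI [of _ B]) (simp_all del: gends.simps)
    qed
  qed (rule E)
  moreover have "{B \<in> M. \<exists>e\<in>rungs A <+> E. \<phi> ` gends e \<inter> B \<noteq> {}} = E \<union> {B \<in> M. \<exists>i\<in>A. Inl i \<in> B}"
  proof (intro equalityI subsetI)
    fix B assume "B \<in> {B \<in> M. \<exists>e\<in>rungs A <+> E. \<phi> ` gends e \<inter> B \<noteq> {}}"
    then obtain e where B: "B \<in> M" and e: "e \<in> rungs A <+> E" "\<phi> ` gends e \<inter> B \<noteq> {}" by blast
    from e(1) show "B \<in> E \<union> {B \<in> M. \<exists>i\<in>A. Inl i \<in> B}"
    proof (elim PlusE)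
      fix a assume "e = Inl a" "a \<in> rungs A"
      then obtain i where i: "i \<in> A" "e = Inl {Inl i, Inr i}" by (auto simp: rungs_def)
      then have "Inl i \<in> B" using e(2) rung [of i] by (simp del: gends.simps)
      then show ?thesis using B i by blast
    next
      fix C assume C: "e = Inr C" "C \<in> E"
      then have "C \<inter> B \<noteq> {}" using e edge by simp
      then have "C = B" using matching_unique [OF M, of C B] C E B by blast
      then show ?thesis using C by simp
    qed
  next
    fix B assume "B \<in> E \<union> {B \<in> M. \<exists>i\<in>A. Inl i \<in> B}"
    then consider "B \<in> E" | i where "B \<in> M" "i \<in> A" "Inl i \<in> B" by blast
    then show "B \<in> {B \<in> M. \<exists>e\<in>rungs A <+> E. \<phi> ` gends e \<inter> B \<noteq> {}}"
    proof cases
      case 1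
      then have "B \<in> M" "B \<noteq> {}" using E matching_card [OF M, of B] by auto
      then show ?thesis
        using 1 edge [of B] by (intro CollectI conjI bexI [of _ "Inr B"]) (simp_all add: InrI del: gends.simps)
    next
      case 2
      then have "Inl {Inl i, Inr i} \<in> rungs A <+> E" by (auto simp: rungs_def)
      then show ?thesis
        using 2 rung [of i] by (intro CollectI conjI bexI [of _ "Inl {Inl i, Inr i}"]) (simp_all del: gends.simps)
    qed
  qed
  ultimately show ?thesis by simp
qed

text \<open>The mirror image of \<open>edge_sum_rungs_left\<close>: the rungs lie below, and middle
  vertices are contracted downwards.\<close>

lemma edge_sum_rungs_right:
  assumes M: "matching k M" and A: "\<And>i. i \<in> A \<Longrightarrow> Inr i \<in> \<Union>M" and E: "E \<subseteq> M"
  shows "edge_sum k M E \<otimes>\<^bsub>PB k \<delta> 1\<^esub> edge_sum k (rungs {1..k}) (rungs A) =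
    edge_sum k M (E \<union> {B \<in> M. \<exists>i\<in>A. Inr i \<in> B})"
proof -
  interpret gamma_graph k M "rungs {1..k}"
    by standard (rule matching_rungs M)+
  define \<phi> :: "gvertex \<Rightarrow> nat + nat" where "\<phi> = case_gvertex Inl Inr Inr"
  have rung: "\<phi> ` gends (Inr {Inl i, Inr i}) = {Inr i}" for i
    by (auto simp: \<phi>_def)
  have "\<phi> (case_sum Upper Middle x) = x" for x
    by (cases x) (auto simp: \<phi>_def)
  then have edge: "\<phi> ` gends (Inl B) = B" for B
    by (simp add: image_image)
  have A': "i \<in> {1..k}" if "i \<in> A" for i
    using A [OF that] matching_verts [OF M] by (auto dest: matching_verts [OF M])
  have "edge_sum k M E \<otimes>\<^bsub>PB k \<delta> 1\<^esub> edge_sum k (rungs {1..k}) (rungs A) =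
      edge_sum k M {B \<in> M. \<exists>e\<in>E <+> rungs A. \<phi> ` gends e \<inter> B \<noteq> {}}"
  proof (rule edge_sum_mult_retract [OF M])
    show "\<phi> (outer x) = x" for x
      by (cases x) (auto simp: \<phi>_def)
    show "(v, outer (\<phi> v)) \<in> conn gends G" if "v \<in> gverts k" for v
    proof (cases v)
      case (Middle i)
      then have "i \<in> {1..k}" using that by (auto simp: gverts_def)
      then have "Inr {Inl i, Inr i} \<in> G" by (auto simp: rungs_def)
      then have "(Middle i, Lower i) \<in> conn gends G" by (rule conn_ends) auto
      then show ?thesis using Middle by (simp add: \<phi>_def)
    qed (auto simp: \<phi>_def)
    show "\<phi> ` gends e \<in> M \<or> (\<exists>x. \<phi> ` gends e = {x})" if "e \<in> G" for e
      using that rung edge by (auto simp: rungs_def simp del: gends.simps)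
    show "\<exists>e\<in>G. \<phi> ` gends e = B" if "B \<in> M" for B
      using that edge by (intro bexI [of _ "Inl B"]) auto
    show "rungs A \<subseteq> rungs {1..k}" using A' unfolding rungs_def by blast
    show "\<exists>B\<in>M. \<phi> ` gends e \<inter> B \<noteq> {}" if "e \<in> E <+> rungs A" for e
      using that
    proof (elim PlusE)
      fix a assume "e = Inr a" "a \<in> rungs A"
      then show ?thesis using A rung by (auto simp: rungs_def simp del: gends.simps)
    next
      fix B assume B: "e = Inl B" "B \<in> E"
      then have "B \<in> M" "B \<noteq> {}" using E matching_card [OF M, of B] by auto
      then show ?thesis using edge [of B] B by (intro bexI [of _ B]) (simp_all del: gends.simps)
    qed
  qed (rule E)
  moreover have "{B \<in> M. \<exists>e\<in>E <+> rungs A. \<phi> ` gends e \<inter> B \<noteq> {}} = E \<union> {B \<in> M. \<exists>i\<in>A. Inr i \<in> B}"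
  proof (intro equalityI subsetI)
    fix B assume "B \<in> {B \<in> M. \<exists>e\<in>E <+> rungs A. \<phi> ` gends e \<inter> B \<noteq> {}}"
    then obtain e where B: "B \<in> M" and e: "e \<in> E <+> rungs A" "\<phi> ` gends e \<inter> B \<noteq> {}" by blast
    from e(1) show "B \<in> E \<union> {B \<in> M. \<exists>i\<in>A. Inr i \<in> B}"
    proof (elim PlusE)
      fix a assume "e = Inr a" "a \<in> rungs A"
      then obtain i where i: "i \<in> A" "e = Inr {Inl i, Inr i}" by (auto simp: rungs_def)
      then have "Inr i \<in> B" using e(2) rung [of i] by (simp del: gends.simps)
      then show ?thesis using B i by blast
    next
      fix C assume C: "e = Inl C" "C \<in> E"
      then have "C \<inter> B \<noteq> {}" using e edge by simp
      then have "C = B" using matching_unique [OF M, of C B] C E B by blast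
      then show ?thesis using C by simp
    qed
  next
    fix B assume "B \<in> E \<union> {B \<in> M. \<exists>i\<in>A. Inr i \<in> B}"
    then consider "B \<in> E" | i where "B \<in> M" "i \<in> A" "Inr i \<in> B" by blast
    then show "B \<in> {B \<in> M. \<exists>e\<in>E <+> rungs A. \<phi> ` gends e \<inter> B \<noteq> {}}"
    proof cases
      case 1
      then have "B \<in> M" "B \<noteq> {}" using E matching_card [OF M, of B] by auto
      then show ?thesis
        using 1 edge [of B] by (intro CollectI conjI bexI [of _ "Inl B"]) (simp_all add: InlI del: gends.simps)
    next
      case 2
      then have "Inr {Inl i, Inr i} \<in> E <+> rungs A" by (auto simp: rungs_def)
      then show ?thesis
        using 2 rung [of i] by (intro CollectI conjI bexI [of _ "Inr {Inl i, Inr i}"]) (simp_all del: gends.simps)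
    qed
  qed
  ultimately show ?thesis by simp
qed

lemma diagram_of_rungs:
  "diagram_of k (rungs {1..k}) = id_diagram k"
  "i \<in> {1..k} \<Longrightarrow> diagram_of k (rungs {1..k} - {{Inl i, Inr i}}) = p_diagram k i"
proof -
  have "\<Union> (rungs {1..k}) = diagram_verts k"
    by (auto simp: rungs_def diagram_verts_def)
  then show "diagram_of k (rungs {1..k}) = id_diagram k"
    by (simp add: diagram_of_def id_diagram_def rungs_def)
next
  assume i: "i \<in> {1..k}"
  have r: "rungs {1..k} - {{Inl i, Inr i}} = rungs ({1..k} - {i})"
    by (auto simp: rungs_def doubleton_eq_iff)
  have "diagram_verts k - \<Union> (rungs ({1..k} - {i})) = {Inl i, Inr i}"
    using i by (auto simp: rungs_def diagram_verts_def)
  then show "diagram_of k (rungs {1..k} - {{Inl i, Inr i}}) = p_diagram k i"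
    unfolding r by (auto simp: diagram_of_def p_diagram_def rungs_def)
qed

lemma one_minus_p:
  assumes "i \<in> {1..k}"
  shows "\<one>\<^bsub>PB k \<delta> \<delta>'\<^esub> \<ominus>\<^bsub>PB k \<delta> \<delta>'\<^esub> pb_basis (p_diagram k i) = edge_sum k (rungs {1..k}) (rungs {i})"
proof -
  \<comment> \<open>The minus of the record \<open>PB\<close> is a definite description over the
    carrier, so the candidate for the inverse has to be placed there.\<close>
  have "p_diagram k i \<in> pb_diagrams k"
    using diagram_of_in_pb [OF matching_Diff [OF matching_rungs]] diagram_of_rungs(2) [OF assms] by metis
  then have "- pb_basis (p_diagram k i) \<in> carrier (PB k \<delta> \<delta>')"
    by (auto simp: PB_def)
  then have "\<ominus>\<^bsub>PB k \<delta> \<delta>'\<^esub> pb_basis (p_diagram k i) = - pb_basis (p_diagram k i)"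
    unfolding a_inv_def m_inv_def
    by (intro the_equality) (auto simp: add.commute eq_neg_iff_add_eq_0)
  then show ?thesis
    using diagram_of_rungs(1) [of k] diagram_of_rungs(2) [OF assms]
    by (simp add: a_minus_def edge_sum_def rungs_def [of "{i}"] alt_sum_insert)
qed

text \<open>The factors are accumulated by \<open>edge_sum_rungs_left\<close> with \<open>M\<close>
  itself the identity diagram: each makes one more rung deletable.\<close>

lemma one_minus_p_prod_eq:
  assumes "A \<subseteq> {1..k}"
  shows "one_minus_p_prod k \<delta> 1 A = edge_sum k (rungs {1..k}) (rungs A)"
proof -
  have "foldr (\<lambda>i x. (\<one>\<^bsub>PB k \<delta> 1\<^esub> \<ominus>\<^bsub>PB k \<delta> 1\<^esub> pb_basis (p_diagram k i)) \<otimes>\<^bsub>PB k \<delta> 1\<^esub> x) xs \<one>\<^bsub>PB k \<delta> 1\<^esub>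
      = edge_sum k (rungs {1..k}) (rungs (set xs))" if "set xs \<subseteq> {1..k}" for xs
    using that
  proof (induction xs)
    case Nil
    then show ?case using diagram_of_rungs(1) [of k] by (simp add: edge_sum_def rungs_def [of "{}"])
  next
    case (Cons i xs)
    have i: "i \<in> {1..k}" and xs: "set xs \<subseteq> {1..k}" using Cons.prems by auto
    have "edge_sum k (rungs {1..k}) (rungs {i}) \<otimes>\<^bsub>PB k \<delta> 1\<^esub> edge_sum k (rungs {1..k}) (rungs (set xs)) =
        edge_sum k (rungs {1..k}) (rungs (set xs) \<union> {B \<in> rungs {1..k}. \<exists>j\<in>{i}. Inl j \<in> B})"
      by (rule edge_sum_rungs_left [OF matching_rungs]) (use i xs in \<open>auto simp: rungs_def\<close>)
    also have "rungs (set xs) \<union> {B \<in> rungs {1..k}. \<exists>j\<in>{i}. Inl j \<in> B} = rungs (set (i # xs))"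
      using i by (auto simp: rungs_def)
    finally show ?case using Cons.IH [OF xs] one_minus_p [OF i, of \<delta> 1] by simp
  qed
  moreover have "finite A" using assms by (rule finite_subset) simp
  ultimately show ?thesis using assms by (simp add: one_minus_p_prod_def)
qed

lemma edge_sum_empty: "edge_sum k M {} = pb_basis (diagram_of k M)"
  by (simp add: edge_sum_def)

text \<open>A factor 1 - p_i at an endpoint of a horizontal edge makes that edge deletable, and the
  factor at its other endpoint changes nothing further.\<close>

lemma pb_tilde_eq:
  assumes M: "matching k M"
  shows "pb_tilde k \<delta> (diagram_of k M) = edge_sum k M {B \<in> M. is_horizontal B}"
proof -
  let ?T = "top_horiz k (diagram_of k M)" and ?B = "bot_horiz k (diagram_of k M)"
  have T: "?T = {i \<in> {1..k}. \<exists>B\<in>M. is_horizontal B \<and> Inl i \<in> B}"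
    and B: "?B = {i \<in> {1..k}. \<exists>B\<in>M. is_horizontal B \<and> Inr i \<in> B}"
    by (simp_all add: top_horiz_def bot_horiz_def diagram_edges_diagram_of [OF M])
  let ?T' = "{B \<in> M. \<exists>i\<in>?T. Inl i \<in> B}" and ?B' = "{B \<in> M. \<exists>i\<in>?B. Inr i \<in> B}"
  have "edge_sum k (rungs {1..k}) (rungs ?T) \<otimes>\<^bsub>PB k \<delta> 1\<^esub> edge_sum k M {} = edge_sum k M ({} \<union> ?T')"
    by (rule edge_sum_rungs_left [OF M]) (auto simp: T)
  moreover have "edge_sum k M ?T' \<otimes>\<^bsub>PB k \<delta> 1\<^esub> edge_sum k (rungs {1..k}) (rungs ?B) =
      edge_sum k M (?T' \<union> ?B')"
    by (rule edge_sum_rungs_right [OF M]) (auto simp: B)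
  moreover have "?T' \<union> ?B' = {B \<in> M. is_horizontal B}"
  proof (intro equalityI subsetI)
    fix C assume "C \<in> ?T' \<union> ?B'"
    then obtain D x where "C \<in> M" "D \<in> M" "is_horizontal D" "x \<in> C" "x \<in> D"
      unfolding T B by blast
    then show "C \<in> {B \<in> M. is_horizontal B}" using matching_unique [OF M] by blast
  next
    fix C assume C: "C \<in> {B \<in> M. is_horizontal B}"
    then obtain x where x: "x \<in> C" using matching_card [OF M, of C] by fastforce
    then have "x \<in> diagram_verts k" using matching_verts [OF M] C by blast
    then show "C \<in> ?T' \<union> ?B'" using C x unfolding T B by (cases x) auto
  qed
  moreover have "?T \<subseteq> {1..k}" "?B \<subseteq> {1..k}" unfolding T B by blast+
  ultimately show ?thesis
    by (simp only: pb_tilde_def one_minus_p_prod_eq Un_empty_left edge_sum_empty [symmetric])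
qed

section \<open>Components hit by deleted edges\<close>

text \<open>If \<open>w\<close> were isolated, the complement of \<open>{w}\<close> would be closed
  under adjacency, and no edge could reach \<open>w\<close>.\<close>

lemma (in multigraph) component_degree_pos:
  assumes "e \<in> E" "w \<in> conn ends E `` ends e"
  shows "degree ends E w \<noteq> 0"
proof
  assume "degree ends E w = 0"
  then have no: "\<And>f. f \<in> E \<Longrightarrow> w \<notin> ends f" using degree_pos by blast
  obtain v where v: "v \<in> ends e" "(v, w) \<in> conn ends E" using assms(2) by blast
  have "w \<in> - {w}"
    using v(2) by (rule component_closed) (use no assms(1) v in auto)
  then show False by simp
qed

lemma singleton_in_diagram_of:
  assumes "matching k M"
  shows "{x} \<in> diagram_of k M \<longleftrightarrow> x \<in> diagram_verts k \<and> x \<notin> \<Union>M"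
proof -
  have "{x} \<notin> M" using matching_card [OF assms, of "{x}"] by auto
  then show ?thesis by (auto simp: diagram_of_def)
qed

lemma not_horizontal:
  assumes "card B = 2" "\<not> is_horizontal B"
  obtains a b where "B = {Inl a, Inr b}"
proof -
  obtain x y where "B = {x, y}" using assms(1) by (auto simp: card_2_iff)
  then show thesis
    using assms that by (cases x; cases y) (auto simp: is_horizontal_def is_cup_def is_cap_def insert_commute)
qed

lemma vertical_unique:
  assumes "matching k M" "{Inl a, Inr b} \<in> M" "{Inl a', Inr b'} \<in> M"
  shows "a = a' \<longleftrightarrow> b = b'"
  using matching_unique [OF assms, of "Inl a"] matching_unique [OF assms, of "Inr b"]
  by (auto simp: doubleton_eq_iff)

lemma horizontal_cases:
  assumes "is_horizontal B" "card B = 2"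
  obtains i j where "i \<noteq> j" "B = {Inl i, Inl j}" | i j where "i \<noteq> j" "B = {Inr i, Inr j}"
proof -
  obtain x y where xy: "B = {x, y}" "x \<noteq> y" using assms(2) by (auto simp: card_2_iff)
  from assms(1) consider "B \<subseteq> range Inl" | "B \<subseteq> range Inr"
    by (auto simp: is_horizontal_def is_cup_def is_cap_def)
  then show thesis
  proof cases
    case 1
    then obtain i j where "x = Inl i" "y = Inl j" using xy by auto
    then show thesis using xy that(1) [of i j] by simp
  next
    case 2
    then obtain i j where "x = Inr i" "y = Inr j" using xy by auto
    then show thesis using xy that(2) [of i j] by simp
  qed
qed

context gamma_graph
begin

lemma bot_supp_eq: "bot_supp k (diagram_of k M1) = {i. Inr i \<in> \<Union>M1}"
  using matching_verts [OF m1] by (force simp: bot_supp_def singleton_in_diagram_of [OF m1])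

lemma top_supp_eq: "top_supp k (diagram_of k M2) = {i. Inl i \<in> \<Union>M2}"
  using matching_verts [OF m2] by (force simp: top_supp_def singleton_in_diagram_of [OF m2])

text \<open>The middle vertex is already an end of its path; together with the two ends of an edge
  of the composite there would be three.\<close>

lemma dangling_component:
  assumes deg: "degree gends G (Middle i) = 1" and e: "e \<in> G" "Middle i \<in> gends e"
  shows "edge_comp G e \<notin> loops G" "edge_comp G e \<notin> block_comp G ` outer_edges k G"
proof -
  have C: "edge_comp G e = conn gends G `` {Middle i}" by (rule edge_comp_eq [OF e])
  have "Middle i \<in> edge_comp G e" unfolding C by (rule ImageI [OF conn_refl]) simp
  then show "edge_comp G e \<notin> loops G" using deg unfolding loops_def by fastforce
  show "edge_comp G e \<notin> block_comp G ` outer_edges k G"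
  proof
    assume "edge_comp G e \<in> block_comp G ` outer_edges k G"
    then obtain B where B: "B \<in> outer_edges k G" "edge_comp G e = block_comp G B" by blast
    then obtain x y where xy: "B = {x, y}" "x \<noteq> y" unfolding outer_edges_def by blast
    have "outer ` B \<subseteq> block_comp G B" unfolding block_comp_def by (blast intro: ImageI [OF conn_refl])
    then have "{outer x, outer y} \<subseteq> conn gends G `` {Middle i}" using B(2) C xy(1) by simp
    then have "{Middle i, outer x, outer y} \<subseteq> conn gends G `` {Middle i}"
      using \<open>Middle i \<in> edge_comp G e\<close> C by simp
    then have "card {Middle i, outer x, outer y} \<le> 2"
      by (rule component_deficit) (use deg degree_outer in auto)
    moreover have "Middle i \<noteq> outer x" "Middle i \<noteq> outer y" by (cases x; cases y; simp)+
    ultimately show False using xy(2) by simp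
  qed
qed

text \<open>Not being a loop, the component has an outer vertex, which is of degree one. Parity
  yields a second vertex of degree other than two, and this is again outer.\<close>

lemma inner_saturated_component:
  assumes e: "e \<in> G" and deg: "\<And>i. Middle i \<in> edge_comp G e \<Longrightarrow> degree gends G (Middle i) = 2"
    and nl: "edge_comp G e \<notin> loops G"
  shows "edge_comp G e \<in> block_comp G ` outer_edges k G"
proof -
  have pos: "degree gends G w \<noteq> 0" if "w \<in> edge_comp G e" for w
    using component_degree_pos [OF e] that unfolding edge_comp_def by blast
  have outer: "\<exists>x. w = outer x \<and> x \<in> diagram_verts k" if "w \<in> edge_comp G e" "w \<notin> range Middle" for w
  proof -
    have "w \<in> gverts k" using pos [OF that(1)] degree_pos gends_gverts by blast
    then show ?thesis using that(2) by (cases w) (auto simp: gverts_def split_sum_ex)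
  qed
  obtain v where v: "v \<in> gends e" using card_gends [OF e] by fastforce
  have C: "edge_comp G e = conn gends G `` {v}" by (rule edge_comp_eq [OF e v])
  have "\<not> edge_comp G e \<subseteq> range Middle"
  proof
    assume mid: "edge_comp G e \<subseteq> range Middle"
    have "\<forall>w\<in>edge_comp G e. degree gends G w = 2" using mid deg by blast
    then show False using nl mid C unfolding loops_def by blast
  qed
  then obtain w where w: "w \<in> edge_comp G e" "w \<notin> range Middle" by blast
  then obtain x where x: "w = outer x" "x \<in> diagram_verts k" using outer by blast
  have Cw: "edge_comp G e = conn gends G `` {w}"
    using w(1) component_eq C by metis
  have "degree gends G w = 1" using pos [OF w(1)] degree_outer [of x] x by simp
  then obtain w' where w': "w' \<in> conn gends G `` {w}" "w' \<noteq> w" "degree gends G w' \<noteq> 2"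
    using odd_vertex_not_alone by blast
  then have "w' \<notin> range Middle" using deg Cw by blast
  then obtain y where y: "w' = outer y" "y \<in> diagram_verts k" using outer w' Cw by blast
  have "{x, y} \<in> outer_edges k G" unfolding outer_edges_def using x y w' by blast
  moreover have "edge_comp G e = block_comp G {x, y}"
    using block_comp_eq [OF calculation, of x] Cw x by simp
  ultimately show ?thesis by blast
qed

text \<open>The two endpoints of \<open>B\<close> differ, so some edge leaves the first one.\<close>

lemma block_comp_is_edge_comp:
  assumes "B \<in> outer_edges k G"
  shows "block_comp G B \<in> edge_comp G ` G"
proof -
  from assms obtain x y where xy: "B = {x, y}" "x \<noteq> y" "(outer x, outer y) \<in> conn gends G"
    unfolding outer_edges_def by blast
  have "\<exists>e\<in>G. outer x \<in> gends e"
  proof (rule ccontr)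
    assume no: "\<not> (\<exists>e\<in>G. outer x \<in> gends e)"
    have "outer y \<in> {outer x}" using xy(3) by (rule component_closed) (use no in auto)
    then show False using xy(2) by simp
  qed
  then obtain e where e: "e \<in> G" "outer x \<in> gends e" by blast
  have "block_comp G B = edge_comp G e"
    using block_comp_eq [OF assms, of x] edge_comp_eq [OF e] xy(1) by simp
  then show ?thesis using e by blast
qed

text \<open>The supports differ exactly when some middle vertex has degree one, and then its
  dangling path annihilates the product. Otherwise every component with an edge is a loop or joins
  two outer vertices.\<close>

lemma edge_sum_mult_all:
  "edge_sum k M1 M1 \<otimes>\<^bsub>PB k \<delta> 1\<^esub> edge_sum k M2 M2 =
    (if {i. Inr i \<in> \<Union>M1} = {i. Inl i \<in> \<Union>M2}
     then (\<delta> - 1) ^ card (loops G) \<odot>\<^bsub>PB k \<delta> 1\<^esub> edge_sum k (outer_edges k G) (outer_edges k G)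
     else 0)"
proof (cases "{i. Inr i \<in> \<Union>M1} = {i. Inl i \<in> \<Union>M2}")
  case True
  then have deg: "degree gends G (Middle i) \<noteq> 1" for i
    by (auto simp: degree_Middle simp del: Union_iff)
  have "edge_sum k M1 M1 \<otimes>\<^bsub>PB k \<delta> 1\<^esub> edge_sum k M2 M2 =
    (\<delta> - 1) ^ card (loops G) \<odot>\<^bsub>PB k \<delta> 1\<^esub>
      edge_sum k (outer_edges k G) {B \<in> outer_edges k G. block_comp G B \<in> edge_comp G ` G}"
  proof (rule edge_sum_mult_good)
    show "loops G \<subseteq> edge_comp G ` G" by (rule subsetI) (erule loops_are_edge_comps, blast)
    show "edge_comp G e \<in> block_comp G ` outer_edges k G" if "e \<in> G" "edge_comp G e \<notin> loops G" for e
    proof (rule inner_saturated_component [OF that(1) _ that(2)])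
      fix i assume "Middle i \<in> edge_comp G e"
      then have "degree gends G (Middle i) \<noteq> 0"
        using component_degree_pos [OF that(1)] unfolding edge_comp_def by blast
      then show "degree gends G (Middle i) = 2" using deg [of i] degree_le2 [of "Middle i"] by linarith
    qed
  qed simp_all
  moreover have "{B \<in> outer_edges k G. block_comp G B \<in> edge_comp G ` G} = outer_edges k G"
    using block_comp_is_edge_comp by blast
  ultimately show ?thesis using True by simp
next
  case False
  then obtain i where "(Inr i \<in> \<Union>M1) \<noteq> (Inl i \<in> \<Union>M2)" by blast
  then have deg: "degree gends G (Middle i) = 1" by (auto simp: degree_Middle simp del: Union_iff)
  then have "degree gends G (Middle i) \<noteq> 0" by simp
  then obtain e where e: "e \<in> G" "Middle i \<in> gends e" using degree_pos by blast
  have "edge_sum k M1 M1 \<otimes>\<^bsub>PB k \<delta> 1\<^esub> edge_sum k M2 M2 = 0"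
    by (rule edge_sum_mult_0 [OF subset_refl subset_refl e(1) dangling_component [OF deg e]])
  then show ?thesis using False by simp
qed

text \<open>Both ends of \<open>f\<close> have degree at most one, so \<open>f\<close> is a whole
  component. Such a dangling path is harmless in (b), as it contains no horizontal edge.\<close>

lemma vertical_component:
  assumes f: "f \<in> G" "\<not> ghorizontal f" "Middle i \<in> gends f" and deg: "degree gends G (Middle i) = 1"
    and e: "e \<in> G" "Middle i \<in> edge_comp G e"
  shows "e = f"
proof -
  obtain x where x: "gends f = {Middle i, outer x}"
    using f(1)
  proof (elim PlusE)
    fix B assume B: "f = Inl B" "B \<in> M1"
    then obtain a b where "B = {Inl a, Inr b}"
      using f(2) matching_card [OF m1] not_horizontal [of B] by auto
    then show thesis using B f(3) that [of "Inl a"] by auto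
  next
    fix B assume B: "f = Inr B" "B \<in> M2"
    then obtain a b where "B = {Inl a, Inr b}"
      using f(2) matching_card [OF m2] not_horizontal [of B] by auto
    then show thesis using B f(3) that [of "Inr b"] by auto
  qed
  have only: "h = f" if h: "h \<in> G" "gends h \<inter> gends f \<noteq> {}" for h
  proof -
    obtain v where v: "v \<in> gends h" "v \<in> gends f" using h by blast
    have "degree gends G v \<le> 1" using v x deg degree_outer [of x] by auto
    then show ?thesis
      unfolding degree_def using v h f(1) fin card_le_Suc0_iff_eq [of "{e \<in> G. v \<in> gends e}"] by auto
  qed
  obtain w where w: "w \<in> gends e" "(w, Middle i) \<in> conn gends G"
    using e(2) unfolding edge_comp_def by blast
  have "w \<in> gends f"
    using conn_sym [OF w(2)] f(3) by (rule component_closed) (use only in blast)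
  then show "e = f" using only e(1) w(1) by blast
qed

text \<open>A path made of vertical edges only passes straight from one outer row to the other, so
  it cannot return to the row where it began.\<close>

lemma horizontal_outer_edge:
  assumes B: "B \<in> outer_edges k G" "is_horizontal B"
  shows "\<exists>e\<in>G. ghorizontal e \<and> block_comp G B = edge_comp G e"
proof (rule ccontr)
  assume no: "\<not> ?thesis"
  have vert: "\<not> ghorizontal e" if "e \<in> G" "gends e \<inter> block_comp G B \<noteq> {}" for e
  proof
    assume h: "ghorizontal e"
    obtain x where x: "x \<in> B" using B(1) unfolding outer_edges_def by blast
    have "block_comp G B = conn gends G `` {outer x}" by (rule block_comp_eq [OF B(1) x])
    then have "block_comp G B = edge_comp G e" using edge_comp_eq_iff [OF that(1), of "outer x"] that(2) by simp
    then show False using no h that(1) by blast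
  qed
  have B2: "card B = 2" using matching_card [OF matching_outer_edges B(1)] .
  have adj1: "(Upper a, Middle b) \<in> conn gends G" if "{Inl a, Inr b} \<in> M1" for a b
    using that by (intro conn_ends [of "Inl {Inl a, Inr b}"]) auto
  have adj2: "(Middle b, Lower c) \<in> conn gends G" if "{Inl b, Inr c} \<in> M2" for b c
    using that by (intro conn_ends [of "Inr {Inl b, Inr c}"]) auto
  show False
    using B(2) B2
  proof (cases rule: horizontal_cases)
    case (1 i j)
    \<comment> \<open>The straight descent from \<open>Upper i\<close>: it is closed under adjacency
      as long as no horizontal edge is met, and contains no other upper vertex.\<close>
    define A where "A = {Upper i} \<union> {Middle b | b. {Inl i, Inr b} \<in> M1} \<union>
      {Lower c | b c. {Inl i, Inr b} \<in> M1 \<and> {Inl b, Inr c} \<in> M2}"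
    have comp: "block_comp G B = conn gends G `` {Upper i}"
      using block_comp_eq [OF B(1), of "Inl i"] 1 by simp
    have A: "A \<subseteq> block_comp G B"
      unfolding A_def comp using adj1 conn_trans [OF adj1 adj2] by auto
    have "Upper j \<in> block_comp G B"
      unfolding block_comp_def 1 by (rule ImageI [OF conn_refl]) (auto simp: image_iff)
    then have "(Upper i, Upper j) \<in> conn gends G" using comp by simp
    then have "Upper j \<in> A"
    proof (rule component_closed)
      fix e assume e: "e \<in> G" "gends e \<inter> A \<noteq> {}"
      then have nh: "\<not> ghorizontal e" using vert A by blast
      from e(1) show "gends e \<subseteq> A"
      proof (elim PlusE)
        fix C assume C: "e = Inl C" "C \<in> M1"
        then obtain a b where ab: "C = {Inl a, Inr b}"
          using nh matching_card [OF m1] not_horizontal [of C] by auto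
        then have "Upper a \<in> A \<or> Middle b \<in> A" using e(2) C by auto
        then have "a = i" using vertical_unique [OF m1, of a b i b] C ab by (auto simp: A_def)
        then show ?thesis using C ab by (auto simp: A_def)
      next
        fix C assume C: "e = Inr C" "C \<in> M2"
        then obtain b c where bc: "C = {Inl b, Inr c}"
          using nh matching_card [OF m2] not_horizontal [of C] by auto
        then have "Middle b \<in> A \<or> Lower c \<in> A" using e(2) C by auto
        then obtain b' where b': "{Inl i, Inr b'} \<in> M1" "b' = b \<or> {Inl b', Inr c} \<in> M2"
          by (auto simp: A_def)
        then have "{Inl i, Inr b} \<in> M1" using vertical_unique [OF m2, of b' c b c] C bc by auto
        then show ?thesis using C bc by (auto simp: A_def)
      qed
    qed (simp add: A_def)
    then show False using 1 by (auto simp: A_def)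
  next
    case (2 i j)
    \<comment> \<open>The same set read upwards from \<open>Lower i\<close>.\<close>
    define A where "A = {Lower i} \<union> {Middle b | b. {Inl b, Inr i} \<in> M2} \<union>
      {Upper c | b c. {Inl b, Inr i} \<in> M2 \<and> {Inl c, Inr b} \<in> M1}"
    have comp: "block_comp G B = conn gends G `` {Lower i}"
      using block_comp_eq [OF B(1), of "Inr i"] 2 by simp
    have A: "A \<subseteq> block_comp G B"
      unfolding A_def comp
      using adj2 [THEN conn_sym] conn_trans [OF adj2 [THEN conn_sym] adj1 [THEN conn_sym]] by auto
    have "Lower j \<in> block_comp G B"
      unfolding block_comp_def 2 by (rule ImageI [OF conn_refl]) (auto simp: image_iff)
    then have "(Lower i, Lower j) \<in> conn gends G" using comp by simp
    then have "Lower j \<in> A"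
    proof (rule component_closed)
      fix e assume e: "e \<in> G" "gends e \<inter> A \<noteq> {}"
      then have nh: "\<not> ghorizontal e" using vert A by blast
      from e(1) show "gends e \<subseteq> A"
      proof (elim PlusE)
        fix C assume C: "e = Inr C" "C \<in> M2"
        then obtain a b where ab: "C = {Inl a, Inr b}"
          using nh matching_card [OF m2] not_horizontal [of C] by auto
        then have "Middle a \<in> A \<or> Lower b \<in> A" using e(2) C by auto
        then have "b = i" using vertical_unique [OF m2, of a b a i] C ab by (auto simp: A_def)
        then show ?thesis using C ab by (auto simp: A_def)
      next
        fix C assume C: "e = Inl C" "C \<in> M1"
        then obtain c b where cb: "C = {Inl c, Inr b}"
          using nh matching_card [OF m1] not_horizontal [of C] by auto
        then have "Upper c \<in> A \<or> Middle b \<in> A" using e(2) C by auto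
        then obtain b' where b': "{Inl b', Inr i} \<in> M2" "b' = b \<or> {Inl c, Inr b'} \<in> M1"
          by (auto simp: A_def)
        then have "{Inl b, Inr i} \<in> M2" using vertical_unique [OF m1, of c b' c b] C cb by auto
        then show ?thesis using C cb by (auto simp: A_def)
      qed
    qed (simp add: A_def)
    then show False using 2 by (auto simp: A_def)
  qed
qed

text \<open>By \<open>path_through\<close> the choice of path is immaterial: having a horizontal
  edge on the path is a property of the component.\<close>

lemma snakes_iff:
  assumes B: "{Inl i, Inr j} \<in> outer_edges k G"
  shows "i \<in> snakes k (diagram_of k M1) (diagram_of k M2) \<longleftrightarrow>
    (\<exists>e\<in>G. ghorizontal e \<and> block_comp G {Inl i, Inr j} = edge_comp G e)"
proof
  have comp: "block_comp G {Inl i, Inr j} = conn gends G `` {Upper i}"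
    using block_comp_eq [OF B, of "Inl i"] by simp
  {
    assume "i \<in> snakes k (diagram_of k M1) (diagram_of k M2)"
    then obtain vs es e where p: "gpath (diagram_of k M1) (diagram_of k M2) vs es" "hd vs = Upper i"
        and e: "e \<in> set es" "ghorizontal e"
      unfolding snakes_def by blast
    have path: "is_path gends G vs es"
      using p(1) by (simp add: gpath_def is_path_def gedges_diagram_of)
    then have eG: "e \<in> G" using e(1) by (auto simp: is_path_def in_set_conv_nth)
    obtain v where v: "v \<in> gends e" using card_gends [OF eG] by fastforce
    have "(Upper i, v) \<in> conn gends G" using path_edge_conn [OF path e(1) v] p(2) by simp
    then have "block_comp G {Inl i, Inr j} = edge_comp G e"
      using comp edge_comp_eq_iff [OF eG, of "Upper i"] v by blast
    then show "\<exists>e\<in>G. ghorizontal e \<and> block_comp G {Inl i, Inr j} = edge_comp G e"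
      using eG e(2) by blast
  next
    assume "\<exists>e\<in>G. ghorizontal e \<and> block_comp G {Inl i, Inr j} = edge_comp G e"
    then obtain e where e: "e \<in> G" "ghorizontal e" "edge_comp G e = conn gends G `` {Upper i}"
      using comp by metis
    then have meet: "gends e \<inter> conn gends G `` {outer (Inl i)} \<noteq> {}"
      using edge_comp_eq_iff [OF e(1), of "Upper i"] by simp
    obtain y where "{Inl i, Inr j} = {Inl i, y}" "(outer (Inl i), outer y) \<in> conn gends G"
      using outer_edges_mem [OF B, of "Inl i"] by blast
    then have "(outer (Inl i), outer (Inr j)) \<in> conn gends G"
      by (auto simp: doubleton_eq_iff)
    then obtain vs es where p: "is_path gends G vs es" "hd vs = Upper i" "last vs = Lower j" "e \<in> set es"
      using path_through [OF _ degree_outer degree_outer _ e(1) meet, of "Inr j"] by auto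
    have "gpath (diagram_of k M1) (diagram_of k M2) vs es"
      using p(1) by (simp add: gpath_def is_path_def gedges_diagram_of)
    moreover have "i \<in> {1..k}" "j \<in> {1..k}"
      using matching_verts [OF matching_outer_edges B, of "Inl i"]
        matching_verts [OF matching_outer_edges B, of "Inr j"] by simp_all
    moreover have "{Inl i, Inr j} \<in> diagram_comp k (diagram_of k M1) (diagram_of k M2)"
      unfolding diagram_comp_diagram_of using B by (simp add: diagram_of_def)
    ultimately show "i \<in> snakes k (diagram_of k M1) (diagram_of k M2)"
      unfolding snakes_def using p e(2) by blast
  }
qed

lemma snakes_outer_edge:
  assumes "i \<in> snakes k (diagram_of k M1) (diagram_of k M2)"
  obtains j where "{Inl i, Inr j} \<in> outer_edges k G"
  using assms unfolding snakes_def diagram_comp_diagram_of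
  by (auto simp: diagram_of_def)

text \<open>Either half of \<open>Omega\<close> says that one diagram is isolated at the middle
  vertex while the other has a horizontal edge there.\<close>

lemma Omega_iff:
  "i \<in> Omega k (diagram_of k M1) (diagram_of k M2) \<longleftrightarrow>
    degree gends G (Middle i) = 1 \<and> (\<exists>e\<in>G. ghorizontal e \<and> Middle i \<in> gends e)"
  (is "?L \<longleftrightarrow> ?R")
proof -
  have h: "(\<exists>e\<in>G. ghorizontal e \<and> Middle i \<in> gends e) \<longleftrightarrow>
      (\<exists>B\<in>M1. is_horizontal B \<and> Inr i \<in> B) \<or> (\<exists>B\<in>M2. is_horizontal B \<and> Inl i \<in> B)"
    by (simp add: Plus_def bex_Un gends_simps del: gends.simps)
  have "i \<in> {1..k}" if "Inr i \<in> \<Union>M1 \<or> Inl i \<in> \<Union>M2"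
    using that by (auto dest: matching_verts [OF m1] matching_verts [OF m2])
  then have "?L \<longleftrightarrow> (Inr i \<notin> \<Union>M1 \<and> (\<exists>B\<in>M2. is_horizontal B \<and> Inl i \<in> B)) \<or>
      (Inl i \<notin> \<Union>M2 \<and> (\<exists>B\<in>M1. is_horizontal B \<and> Inr i \<in> B))"
    unfolding Omega_def bot_supp_eq top_supp_eq top_horiz_def bot_horiz_def
      diagram_edges_diagram_of [OF m1] diagram_edges_diagram_of [OF m2] by blast
  also have "\<dots> \<longleftrightarrow> ?R"
    unfolding h degree_Middle by auto
  finally show ?thesis .
qed

text \<open>If \<open>Omega\<close> is empty, a dangling middle vertex has a vertical edge as its
  whole component, so components with a horizontal edge are loops or join outer vertices. The latter
  yield all horizontal edges of the composite and those vertical ones that snake.\<close>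

lemma edge_sum_mult_horizontal:
  defines "S \<equiv> snakes k (diagram_of k M1) (diagram_of k M2)"
  shows "edge_sum k M1 {B \<in> M1. is_horizontal B} \<otimes>\<^bsub>PB k \<delta> 1\<^esub> edge_sum k M2 {B \<in> M2. is_horizontal B} =
    (if Omega k (diagram_of k M1) (diagram_of k M2) = {}
     then (\<delta> - 1) ^ card (loops G) \<odot>\<^bsub>PB k \<delta> 1\<^esub> edge_sum k (outer_edges k G)
       ({B \<in> outer_edges k G. is_horizontal B} \<union> {B \<in> outer_edges k G. \<exists>i\<in>S. Inl i \<in> B})
     else 0)"
proof -
  let ?H1 = "{B \<in> M1. is_horizontal B}" and ?H2 = "{B \<in> M2. is_horizontal B}"
  have H: "?H1 <+> ?H2 = {e \<in> G. ghorizontal e}" by auto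
  have sub: "?H1 \<subseteq> M1" "?H2 \<subseteq> M2" by auto
  show ?thesis
  proof (cases "Omega k (diagram_of k M1) (diagram_of k M2) = {}")
    case False
    then obtain i e where "degree gends G (Middle i) = 1" "e \<in> G" "ghorizontal e" "Middle i \<in> gends e"
      using Omega_iff by blast
    then have "edge_sum k M1 ?H1 \<otimes>\<^bsub>PB k \<delta> 1\<^esub> edge_sum k M2 ?H2 = 0"
      using H by (intro edge_sum_mult_0 [OF sub _ dangling_component]) auto
    then show ?thesis using False by simp
  next
    case True
    let ?O = "outer_edges k G"
    have "edge_sum k M1 ?H1 \<otimes>\<^bsub>PB k \<delta> 1\<^esub> edge_sum k M2 ?H2 = (\<delta> - 1) ^ card (loops G) \<odot>\<^bsub>PB k \<delta> 1\<^esub>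
        edge_sum k ?O {B \<in> ?O. block_comp G B \<in> edge_comp G ` (?H1 <+> ?H2)}"
    proof (rule edge_sum_mult_good [OF sub])
      show "loops G \<subseteq> edge_comp G ` (?H1 <+> ?H2)"
        unfolding H by (rule subsetI) (erule loops_are_edge_comps, blast)
      fix e assume "e \<in> ?H1 <+> ?H2" and nl: "edge_comp G e \<notin> loops G"
      then have e: "e \<in> G" "ghorizontal e" using H by auto
      show "edge_comp G e \<in> block_comp G ` ?O"
      proof (rule inner_saturated_component [OF e(1) _ nl], rule ccontr)
        fix i assume i: "Middle i \<in> edge_comp G e" and n: "degree gends G (Middle i) \<noteq> 2"
        have pos: "degree gends G (Middle i) \<noteq> 0"
          using component_degree_pos [OF e(1)] i unfolding edge_comp_def by blast
        then have deg: "degree gends G (Middle i) = 1"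
          using n degree_le2 [of "Middle i"] by linarith
        obtain f where f: "f \<in> G" "Middle i \<in> gends f" using pos degree_pos by blast
        have "\<not> ghorizontal f" using True Omega_iff [of i] deg f by blast
        then have "e = f" using vertical_component f deg e(1) i by blast
        then show False using e(2) \<open>\<not> ghorizontal f\<close> by blast
      qed
    qed
    moreover have "{B \<in> ?O. block_comp G B \<in> edge_comp G ` (?H1 <+> ?H2)} =
        {B \<in> ?O. is_horizontal B} \<union> {B \<in> ?O. \<exists>i\<in>S. Inl i \<in> B}"
    proof (intro equalityI subsetI)
      fix B assume "B \<in> {B \<in> ?O. block_comp G B \<in> edge_comp G ` (?H1 <+> ?H2)}"
      then obtain e where B: "B \<in> ?O" and e: "e \<in> G" "ghorizontal e" "block_comp G B = edge_comp G e"
        unfolding H by blast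
      show "B \<in> {B \<in> ?O. is_horizontal B} \<union> {B \<in> ?O. \<exists>i\<in>S. Inl i \<in> B}"
      proof (cases "is_horizontal B")
        case False
        then obtain i j where ij: "B = {Inl i, Inr j}"
          using not_horizontal matching_card [OF matching_outer_edges B] by blast
        then have "i \<in> S" unfolding S_def using snakes_iff B e by blast
        then show ?thesis using B ij by blast
      qed (use B in simp)
    next
      fix B assume "B \<in> {B \<in> ?O. is_horizontal B} \<union> {B \<in> ?O. \<exists>i\<in>S. Inl i \<in> B}"
      then consider "B \<in> ?O" "is_horizontal B" | i where "B \<in> ?O" "i \<in> S" "Inl i \<in> B" by blast
      then show "B \<in> {B \<in> ?O. block_comp G B \<in> edge_comp G ` (?H1 <+> ?H2)}"
      proof cases
        case 1
        then show ?thesis using horizontal_outer_edge [OF 1] unfolding H by blast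
      next
        case 2
        obtain j where j: "{Inl i, Inr j} \<in> ?O" using snakes_outer_edge 2(2) unfolding S_def by blast
        then have "B = {Inl i, Inr j}"
          using matching_unique [OF matching_outer_edges 2(1) j 2(3)] by simp
        then show ?thesis using snakes_iff [OF j] 2(1,2) unfolding S_def H by blast
      qed
    qed
    ultimately show ?thesis using True by simp
  qed
qed

end

theorem theorem2p5:
  fixes k :: nat and \<delta> :: "'a::{comm_ring,comm_monoid_mult}" and d1 d2 d3 :: diagram
  assumes "d1 \<in> pb_diagrams k" and "d2 \<in> pb_diagrams k"
    and "d3 = diagram_comp k d1 d2"
  shows "pb_bar k d1 \<otimes>\<^bsub>PB k \<delta> 1\<^esub> pb_bar k d2 =
           (if bot_supp k d1 = top_supp k d2
            then (\<delta> - 1) ^ N1 k d1 d2 \<odot>\<^bsub>PB k \<delta> 1\<^esub> pb_bar k d3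
            else \<zero>\<^bsub>PB k \<delta> 1\<^esub>)
         \<and> pb_tilde k \<delta> d1 \<otimes>\<^bsub>PB k \<delta> 1\<^esub> pb_tilde k \<delta> d2 =
           (if Omega k d1 d2 = {}
            then (\<delta> - 1) ^ N1 k d1 d2 \<odot>\<^bsub>PB k \<delta> 1\<^esub>
                   (one_minus_p_prod k \<delta> 1 (snakes k d1 d2) \<otimes>\<^bsub>PB k \<delta> 1\<^esub> pb_tilde k \<delta> d3)
            else \<zero>\<^bsub>PB k \<delta> 1\<^esub>)"
proof -
  define M1 M2 where "M1 = diagram_edges d1" and "M2 = diagram_edges d2"
  interpret gamma_graph k M1 M2
    unfolding M1_def M2_def by standard (intro matching_diagram_edges assms)+
  let ?O = "outer_edges k G" and ?S = "snakes k d1 d2"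
  have d: "d1 = diagram_of k M1" "d2 = diagram_of k M2"
    unfolding M1_def M2_def by (simp_all add: diagram_of_diagram_edges assms)
  have d3: "d3 = diagram_of k ?O" unfolding assms(3) d by (rule diagram_comp_diagram_of)
  have N1: "N1 k d1 d2 = card (loops G)" unfolding d by (rule N1_diagram_of)
  have "?S \<subseteq> {1..k}" by (auto simp: snakes_def)
  then have "one_minus_p_prod k \<delta> 1 ?S \<otimes>\<^bsub>PB k \<delta> 1\<^esub> pb_tilde k \<delta> d3 =
      edge_sum k (rungs {1..k}) (rungs ?S) \<otimes>\<^bsub>PB k \<delta> 1\<^esub> edge_sum k ?O {B \<in> ?O. is_horizontal B}"
    unfolding d3 by (simp only: one_minus_p_prod_eq pb_tilde_eq [OF matching_outer_edges])
  \<comment> \<open>The factors over \<open>?S\<close> add the snaking vertical edges to the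
    deletable ones, which matches \<open>edge_sum_mult_horizontal\<close>.\<close>
  also have "\<dots> = edge_sum k ?O ({B \<in> ?O. is_horizontal B} \<union> {B \<in> ?O. \<exists>i\<in>?S. Inl i \<in> B})"
  proof (rule edge_sum_rungs_left [OF matching_outer_edges])
    fix i assume "i \<in> ?S"
    then obtain j where "{Inl i, Inr j} \<in> ?O" unfolding d by (rule snakes_outer_edge)
    then show "Inl i \<in> \<Union> ?O" by blast
  qed blast
  finally have snake: "one_minus_p_prod k \<delta> 1 ?S \<otimes>\<^bsub>PB k \<delta> 1\<^esub> pb_tilde k \<delta> d3 = \<dots>" .
  show ?thesis
    unfolding snake N1 unfolding d d3
    unfolding pb_bar_eq [OF m1] pb_bar_eq [OF m2] pb_bar_eq [OF matching_outer_edges]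
      pb_tilde_eq [OF m1] pb_tilde_eq [OF m2] edge_sum_mult_all edge_sum_mult_horizontal
      bot_supp_eq top_supp_eq PB_simps
    by simp
qed

end
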